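(* Let $x_1,\dots,x_m\in\mathbb V\cong C$ ($m\ge1$) be pairwise perpendicular with respect to $h$, with all valuations $r(x_i)=v(h(x_i,x_i))$ nonnegative integers, ordered so that $r(x_1)\le\dots\le r(x_m)$. Let $\mathcal S(x_1,\dots,x_m)=\{\Lambda\in\mathcal L: x_i\in\Lambda^\sharp\ \forall\,1\le i\le m\}$. Then $\mathcal S(x_1,\dots,x_m)$ is equal to the simplicial complex $S_0$ computed by the following algorithm: (0) Set $s:=\lfloor r(x_m)/2\rfloor$. Set $S'_{s+1}:=\mathcal L_{2s+2}$. (1) Set $S_s:=\{\Lambda\in\mathcal L_{2s}\mid \exists\,\tilde\Lambda\in\Phi_s(S'_{s+1}):\ \Lambda\subseteq\tilde\Lambda\}$. (2) Set $S'_s:=\{\Lambda\in\mathcal L_{2s}\mid\exists\,\tilde\Lambda\in\mathcal L_{2s},\ \hat\Lambda\in S_s:\ \Lambda\subseteq\tilde\Lambda,\ \hat\Lambda\subseteq\tilde\Lambda\}$. (3) If $s=0$, stop; else replace $s$ by $s-1$ and go to Step (1).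
   Context: $p$ is an odd prime, $n\ge1$, $v$ is the $p$-adic valuation. $(C,h)$ is an $n$-dimensional non-degenerate hermitian space over $\mathbb Q_{p^2}$ (with respect to $\mathbb Q_{p^2}/\mathbb Q_p$) whose determinant has odd valuation; the space $(\mathbb V,h)$ of special homomorphisms is identified with $(C,h)$ (Kudla–Rapoport), so special homomorphisms are elements of $C$. For a lattice $\Lambda$ in a non-degenerate hermitian subspace $C'\subseteq C$, $\Lambda^\sharp=\{y\in C': h(y,\Lambda)\subseteq\mathbb Z_{p^2}\}$. $\mathcal L$ is the set of $\mathbb Z_{p^2}$-lattices $\Lambda\subset C$ with $p\Lambda\subseteq\Lambda^\sharp\subset\Lambda$, a simplicial complex in which two distinct lattices are neighbours iff one contains the other. For an integer $r\ge0$: $m_r:=\max\{i: r(x_i)<r\}$ (with $m_r=0$ if there is no such $i$); $C_r$ is the orthogonal complement in $C$ of $\mathrm{span}_{\mathbb Q_{p^2}}(x_1,\dots,x_{m_r})$; $\mathcal L_r:=\{\Lambda\subset C_r\text{ a }\mathbb Z_{p^2}\text{-lattice}\mid p\Lambda\subseteq\Lambda^\sharp\subseteq\Lambda\}$, again a simplicial complex with neighbours given by proper inclusion (if $C_r=0$ it is a single point). In particular $\mathcal L_0=\mathcal L$. For $s\ge0$ the injective morphism of simplicial complexes $\Phi_s:\mathcal L_{2s+2}\to\mathcal L_{2s}$ is $$\Phi_s(\Lambda)=\Big(\bigoplus_{i=m_{2s}+1}^{m_{2s+2}}p^{-a_i}\mathbb Z_{p^2}x_i\Big)\oplus\Lambda\subset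 C_{2s},$$ where $a_i=r(x_i)/2$ if $r(x_i)$ is even and $a_i=(r(x_i)+1)/2$ if $r(x_i)$ is odd. *)

theory Defs
  imports Complex_Main "HOL-Computational_Algebra.Primes" "Jordan_Normal_Form.Determinant"
begin

section \<open>The field extension\<close>

text \<open>Valuations take values in \<^typ>\<open>int\<close>; the value at \<open>0\<close> is irrelevant and
  is never used. \<open>val_ge v N a\<close> is \<open>v a \<ge> N\<close> with the convention \<open>v 0 = \<infinity>\<close>.\<close>

definition val_ge :: "('k::field \<Rightarrow> int) \<Rightarrow> int \<Rightarrow> 'k \<Rightarrow> bool" where
  "val_ge v N a \<longleftrightarrow> a = 0 \<or> N \<le> v a"

definition integer_ring :: "('k::field \<Rightarrow> int) \<Rightarrow> 'k set" where
  "integer_ring v = {a. val_ge v 0 a}"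

text \<open>The topological closure of the rational numbers. If it is complete and \<open>v\<close> extends the
  \<open>p\<close>-adic valuation, then it is the completion of the rationals at \<open>p\<close>.\<close>

definition rat_closure :: "('k::field_char_0 \<Rightarrow> int) \<Rightarrow> 'k set" where
  "rat_closure v = {a. \<forall>N. \<exists>q\<in>\<rat>. val_ge v N (a - q)}"

definition val_complete :: "('k::field \<Rightarrow> int) \<Rightarrow> 'k set \<Rightarrow> bool" where
  "val_complete v F \<longleftrightarrow>
     (\<forall>u::nat \<Rightarrow> 'k. (\<forall>i. u i \<in> F) \<and> (\<forall>N. \<exists>M. \<forall>i\<ge>M. \<forall>j\<ge>M. val_ge v N (u i - u j)) \<longrightarrow>
        (\<exists>a\<in>F. \<forall>N. \<exists>M. \<forall>i\<ge>M. val_ge v N (u i - a)))"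

text \<open>The type \<open>'k\<close> is the unramified quadratic extension of the field of \<open>p\<close>-adic numbers: the
  closure of the rationals is the \<open>p\<close>-adic field, \<open>'k\<close> has degree 2 over it, and the ramification
  index is 1 because the integer-valued valuation \<open>v\<close> of \<open>'k\<close> extends the \<open>p\<close>-adic one without
  rescaling (so that \<open>v p = 1\<close>). The map \<open>\<sigma>\<close> is the nontrivial Galois automorphism.\<close>

locale unramified_quadratic_extension =
  fixes p :: nat
    and v :: "'k::field_char_0 \<Rightarrow> int"
    and \<sigma> :: "'k \<Rightarrow> 'k"
  assumes prime_p: "prime p"
    and val_mult: "a \<noteq> 0 \<Longrightarrow> b \<noteq> 0 \<Longrightarrow> v (a * b) = v a + v b"
    and val_add: "a \<noteq> 0 \<Longrightarrow> b \<noteq> 0 \<Longrightarrow> a + b \<noteq> 0 \<Longrightarrow> min (v a) (v b) \<le> v (a + b)"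
    and val_of_int: "m \<noteq> 0 \<Longrightarrow> v (of_int m) = int (multiplicity (int p) m)"
    and complete: "val_complete v (rat_closure v)"
    and degree_2: "\<exists>\<theta>. \<theta> \<notin> rat_closure v \<and>
                     (\<forall>a. \<exists>b\<in>rat_closure v. \<exists>c\<in>rat_closure v. a = b + c * \<theta>)"
    and conj_add: "\<sigma> (a + b) = \<sigma> a + \<sigma> b"
    and conj_mult: "\<sigma> (a * b) = \<sigma> a * \<sigma> b"
    and conj_base: "a \<in> rat_closure v \<Longrightarrow> \<sigma> a = a"
    and conj_nontrivial: "\<exists>a. \<sigma> a \<noteq> a"

section \<open>Hermitian spaces and lattices\<close>

text \<open>The hermitian space is the whole type \<open>'c\<close>.\<close>

locale hermitian_space =
  unramified_quadratic_extension p v \<sigma> + vector_space scale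
  for p :: nat
    and v :: "'k::field_char_0 \<Rightarrow> int"
    and \<sigma> :: "'k \<Rightarrow> 'k"
    and scale :: "'k \<Rightarrow> 'c::ab_group_add \<Rightarrow> 'c" +
  fixes h :: "'c \<Rightarrow> 'c \<Rightarrow> 'k"
  assumes form_add: "h (x + y) z = h x z + h y z"
    and form_scale: "h (scale a x) y = a * h x y"
    and form_conj: "h y x = \<sigma> (h x y)"
    and nondegenerate: "(\<And>y. h x y = 0) \<Longrightarrow> x = 0"

definition is_basis :: "('k::field \<Rightarrow> 'c::ab_group_add \<Rightarrow> 'c) \<Rightarrow> nat \<Rightarrow> (nat \<Rightarrow> 'c) \<Rightarrow> bool" where
  "is_basis scale n b \<longleftrightarrow> inj_on b {0..<n} \<and> \<not> module.dependent scale (b ` {0..<n}) \<and>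
     module.span scale (b ` {0..<n}) = UNIV"

definition gram_matrix :: "('c \<Rightarrow> 'c \<Rightarrow> 'k) \<Rightarrow> nat \<Rightarrow> (nat \<Rightarrow> 'c) \<Rightarrow> 'k mat" where
  "gram_matrix h n b = mat n n (\<lambda>(i, j). h (b i) (b j))"

definition orth_compl :: "('c \<Rightarrow> 'c \<Rightarrow> 'k::field) \<Rightarrow> 'c set \<Rightarrow> 'c set" where
  "orth_compl h U = {y. \<forall>u\<in>U. h y u = 0}"

definition integral_span ::
  "('k::field \<Rightarrow> int) \<Rightarrow> ('k \<Rightarrow> 'c::ab_group_add \<Rightarrow> 'c) \<Rightarrow> 'c set \<Rightarrow> 'c set" where
  "integral_span v scale B = {\<Sum>b\<in>B. scale (c b) b | c. \<forall>b\<in>B. c b \<in> integer_ring v}"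

definition is_lattice ::
  "('k::field \<Rightarrow> int) \<Rightarrow> ('k \<Rightarrow> 'c::ab_group_add \<Rightarrow> 'c) \<Rightarrow> 'c set \<Rightarrow> 'c set \<Rightarrow> bool" where
  "is_lattice v scale W \<Lambda> \<longleftrightarrow>
     (\<exists>B. finite B \<and> \<Lambda> = integral_span v scale B \<and> module.span scale \<Lambda> = W)"

text \<open>The dual is taken inside the subspace \<open>W\<close>.\<close>

definition dual :: "('k::field \<Rightarrow> int) \<Rightarrow> ('c \<Rightarrow> 'c \<Rightarrow> 'k) \<Rightarrow> 'c set \<Rightarrow> 'c set \<Rightarrow> 'c set" where
  "dual v h W \<Lambda> = {y\<in>W. \<forall>x\<in>\<Lambda>. h y x \<in> integer_ring v}"

text \<open>The simplicial complexes are full subcomplexes of complexes whose simplices are determined by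
  inclusion of lattices, so each of them is represented by its set of vertices.\<close>

definition vertex_lattices ::
  "nat \<Rightarrow> ('k::field \<Rightarrow> int) \<Rightarrow> ('k \<Rightarrow> 'c::ab_group_add \<Rightarrow> 'c) \<Rightarrow> ('c \<Rightarrow> 'c \<Rightarrow> 'k) \<Rightarrow>
   'c set \<Rightarrow> 'c set set" where
  "vertex_lattices p v scale h W =
     {\<Lambda>. is_lattice v scale W \<Lambda> \<and> scale (of_nat p) ` \<Lambda> \<subseteq> dual v h W \<Lambda> \<and> dual v h W \<Lambda> \<subseteq> \<Lambda>}"

section \<open>The cycle and the algorithm\<close>

definition norm_val :: "('k::field \<Rightarrow> int) \<Rightarrow> ('c \<Rightarrow> 'c \<Rightarrow> 'k) \<Rightarrow> 'c \<Rightarrow> int" where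
  "norm_val v h x = v (h x x)"

text \<open>Throughout, the family \<open>x\<close> is indexed by \<open>{1..m}\<close>.\<close>

definition cycle_lattices ::
  "nat \<Rightarrow> ('k::field \<Rightarrow> int) \<Rightarrow> ('k \<Rightarrow> 'c::ab_group_add \<Rightarrow> 'c) \<Rightarrow> ('c \<Rightarrow> 'c \<Rightarrow> 'k) \<Rightarrow>
   nat \<Rightarrow> (nat \<Rightarrow> 'c) \<Rightarrow> 'c set set" where
  "cycle_lattices p v scale h m x =
     {\<Lambda> \<in> vertex_lattices p v scale h UNIV. \<forall>i\<in>{1..m}. x i \<in> dual v h UNIV \<Lambda>}"

definition m_idx ::
  "('k::field \<Rightarrow> int) \<Rightarrow> ('c \<Rightarrow> 'c \<Rightarrow> 'k) \<Rightarrow> nat \<Rightarrow> (nat \<Rightarrow> 'c) \<Rightarrow> nat \<Rightarrow> nat" where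
  "m_idx v h m x r = Max (insert 0 {i\<in>{1..m}. norm_val v h (x i) < int r})"

definition C_sub ::
  "('k::field \<Rightarrow> int) \<Rightarrow> ('k \<Rightarrow> 'c::ab_group_add \<Rightarrow> 'c) \<Rightarrow> ('c \<Rightarrow> 'c \<Rightarrow> 'k) \<Rightarrow>
   nat \<Rightarrow> (nat \<Rightarrow> 'c) \<Rightarrow> nat \<Rightarrow> 'c set" where
  "C_sub v scale h m x r = orth_compl h (module.span scale (x ` {1..m_idx v h m x r}))"

definition L_sub ::
  "nat \<Rightarrow> ('k::field \<Rightarrow> int) \<Rightarrow> ('k \<Rightarrow> 'c::ab_group_add \<Rightarrow> 'c) \<Rightarrow> ('c \<Rightarrow> 'c \<Rightarrow> 'k) \<Rightarrow>
   nat \<Rightarrow> (nat \<Rightarrow> 'c) \<Rightarrow> nat \<Rightarrow> 'c set set" where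
  "L_sub p v scale h m x r = vertex_lattices p v scale h (C_sub v scale h m x r)"

definition a_exp :: "('k::field \<Rightarrow> int) \<Rightarrow> ('c \<Rightarrow> 'c \<Rightarrow> 'k) \<Rightarrow> 'c \<Rightarrow> int" where
  "a_exp v h y =
     (if even (norm_val v h y) then norm_val v h y div 2 else (norm_val v h y + 1) div 2)"

definition Phi ::
  "nat \<Rightarrow> ('k::field \<Rightarrow> int) \<Rightarrow> ('k \<Rightarrow> 'c::ab_group_add \<Rightarrow> 'c) \<Rightarrow> ('c \<Rightarrow> 'c \<Rightarrow> 'k) \<Rightarrow>
   nat \<Rightarrow> (nat \<Rightarrow> 'c) \<Rightarrow> nat \<Rightarrow> 'c set \<Rightarrow> 'c set" where
  "Phi p v scale h m x s \<Lambda> =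
     {(\<Sum>i\<in>{m_idx v h m x (2*s) + 1..m_idx v h m x (2*s + 2)}.
         scale (c i * of_nat p powi (- a_exp v h (x i))) (x i)) + y
      | c y. (\<forall>i. c i \<in> integer_ring v) \<and> y \<in> \<Lambda>}"

text \<open>\<open>step1 \<dots> s S'\<close> computes \<open>S\<^sub>s\<close> from \<open>S' = S'\<^sub>s\<^sub>+\<^sub>1\<close>, and
  \<open>step2 \<dots> s S\<close> computes \<open>S'\<^sub>s\<close> from \<open>S = S\<^sub>s\<close>.\<close>

definition step1 ::
  "nat \<Rightarrow> ('k::field \<Rightarrow> int) \<Rightarrow> ('k \<Rightarrow> 'c::ab_group_add \<Rightarrow> 'c) \<Rightarrow> ('c \<Rightarrow> 'c \<Rightarrow> 'k) \<Rightarrow>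
   nat \<Rightarrow> (nat \<Rightarrow> 'c) \<Rightarrow> nat \<Rightarrow> 'c set set \<Rightarrow> 'c set set" where
  "step1 p v scale h m x s S' =
     {\<Lambda> \<in> L_sub p v scale h m x (2*s). \<exists>\<Lambda>' \<in> Phi p v scale h m x s ` S'. \<Lambda> \<subseteq> \<Lambda>'}"

definition step2 ::
  "nat \<Rightarrow> ('k::field \<Rightarrow> int) \<Rightarrow> ('k \<Rightarrow> 'c::ab_group_add \<Rightarrow> 'c) \<Rightarrow> ('c \<Rightarrow> 'c \<Rightarrow> 'k) \<Rightarrow>
   nat \<Rightarrow> (nat \<Rightarrow> 'c) \<Rightarrow> nat \<Rightarrow> 'c set set \<Rightarrow> 'c set set" where
  "step2 p v scale h m x s S =
     {\<Lambda> \<in> L_sub p v scale h m x (2*s).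
        \<exists>\<Lambda>' \<in> L_sub p v scale h m x (2*s). \<exists>\<Lambda>'' \<in> S. \<Lambda> \<subseteq> \<Lambda>' \<and> \<Lambda>'' \<subseteq> \<Lambda>'}"

text \<open>\<open>algorithm_loop \<dots> s S'\<close> enters the loop at step (1) with index \<open>s\<close> and
  \<open>S' = S'\<^sub>s\<^sub>+\<^sub>1\<close>, and returns \<open>S\<^sub>0\<close>; step (2) for \<open>s = 0\<close> does not affect the
  result and is not carried out.\<close>

primrec algorithm_loop ::
  "nat \<Rightarrow> ('k::field \<Rightarrow> int) \<Rightarrow> ('k \<Rightarrow> 'c::ab_group_add \<Rightarrow> 'c) \<Rightarrow> ('c \<Rightarrow> 'c \<Rightarrow> 'k) \<Rightarrow>
   nat \<Rightarrow> (nat \<Rightarrow> 'c) \<Rightarrow> nat \<Rightarrow> 'c set set \<Rightarrow> 'c set set" where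
  "algorithm_loop p v scale h m x 0 S' = step1 p v scale h m x 0 S'"
| "algorithm_loop p v scale h m x (Suc s) S' =
     algorithm_loop p v scale h m x s
       (step2 p v scale h m x (Suc s) (step1 p v scale h m x (Suc s) S'))"

definition algorithm_result ::
  "nat \<Rightarrow> ('k::field \<Rightarrow> int) \<Rightarrow> ('k \<Rightarrow> 'c::ab_group_add \<Rightarrow> 'c) \<Rightarrow> ('c \<Rightarrow> 'c \<Rightarrow> 'k) \<Rightarrow>
   nat \<Rightarrow> (nat \<Rightarrow> 'c) \<Rightarrow> 'c set set" where
  "algorithm_result p v scale h m x =
     (let s = nat (norm_val v h (x m) div 2)
      in algorithm_loop p v scale h m x s (L_sub p v scale h m x (2*s + 2)))"

end

theory Submission
  imports Defs
begin

text \<open>The algorithm rescales the vectors. By descending induction on \<open>s\<close>, \<open>S\<^sub>s\<close> consists of the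
  lattices \<open>\<Lambda>\<close> of \<open>\<L>\<^sub>2\<^sub>s\<close> with \<open>p\<^sup>-\<^sup>s x\<^sub>i \<in> \<Lambda>\<^sup>\<sharp>\<close> for all \<open>i > m\<^sub>2\<^sub>s\<close>, and \<open>S'\<^sub>s\<close> of those with
  \<open>p \<cdot> y\<^sub>i \<in> \<Lambda>\<^sup>\<sharp>\<close>, where \<open>y\<^sub>i = p\<^sup>-\<^sup>s x\<^sub>i\<close>.

  Step (1): if all \<open>y\<^sub>i\<close> lie in \<open>\<Lambda>\<^sup>\<sharp>\<close>, then adjoining to \<open>\<Lambda>\<close> the vectors \<open>e\<^sub>i = p\<^sup>-\<^sup>a x\<^sub>i\<close> (\<open>a = a\<^sub>i\<close>)
  for which \<open>y\<^sub>i\<close> has norm of valuation 0 or 1 gives again a vertex lattice with the same property,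
  and the \<open>e\<^sub>i\<close> split off as orthogonal direct summands, because \<open>h z e\<^sub>i / h e\<^sub>i e\<^sub>i\<close> is integral on it.
  The complementary summand is the preimage under \<open>\<Phi>\<^sub>s\<close>.

  Step (2): if all \<open>p \<cdot> y\<^sub>i\<close> lie in \<open>\<Lambda>\<^sup>\<sharp>\<close>, then \<open>\<Lambda>'\<close>, generated by \<open>\<Lambda>\<close> and the \<open>y\<^sub>i\<close>, is a vertex
  lattice. The \<open>y\<^sub>i\<close> span an isotropic subspace of \<open>\<Lambda>' / \<Lambda>'\<^sup>\<sharp>\<close>, so \<open>{z \<in> \<Lambda>'. \<forall>i. h z y\<^sub>i integral}\<close> is a
  vertex lattice inside \<open>\<Lambda>'\<close> whose dual contains all \<open>y\<^sub>i\<close>. Conversely, \<open>y\<^sub>i \<in> \<Lambda>''\<^sup>\<sharp> \<subseteq> \<Lambda>'' \<subseteq> \<Lambda>'\<close> and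
  \<open>\<Lambda> \<subseteq> \<Lambda>'\<close> give \<open>p \<cdot> y\<^sub>i \<in> \<Lambda>'\<^sup>\<sharp> \<subseteq> \<Lambda>\<^sup>\<sharp>\<close>.\<close>

section \<open>Valuation and conjugation\<close>

context unramified_quadratic_extension
begin

lemma v_one [simp]: "v 1 = 0"
  using val_of_int[of 1] by simp

lemma v_minus_one [simp]: "v (- 1) = 0"
  using val_of_int[of "-1"] by (simp add: multiplicity_unit_right)

lemma v_uminus [simp]: "v (- a) = v a"
proof (cases "a = 0")
  case False
  then have "v (-1 * a) = v (-1) + v a"
    by (intro val_mult) auto
  then show ?thesis by simp
qed simp

lemma p_nonzero [simp]: "p \<noteq> 0"
  using prime_p by (auto simp: prime_nat_iff)

lemma v_p [simp]: "v (of_nat p) = 1"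
proof -
  have "int p \<noteq> 0" "\<not> is_unit (int p)"
    using prime_p by (auto simp: prime_nat_iff)
  then show ?thesis
    using val_of_int[of "int p"] by (simp add: multiplicity_self)
qed

lemma v_inverse: "a \<noteq> 0 \<Longrightarrow> v (inverse a) = - v a"
  using val_mult[of a "inverse a"] by simp

lemma v_divide: "a \<noteq> 0 \<Longrightarrow> b \<noteq> 0 \<Longrightarrow> v (a / b) = v a - v b"
  by (simp add: divide_inverse val_mult v_inverse)

lemma v_power: "a \<noteq> 0 \<Longrightarrow> v (a ^ k) = int k * v a"
  by (induction k) (auto simp: val_mult algebra_simps)

lemma v_power_int: "a \<noteq> 0 \<Longrightarrow> v (a powi k) = k * v a"
  by (auto simp: power_int_def v_power v_inverse)

section \<open>Valuation bounds and the ring of integers\<close>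

lemma val_ge_0 [simp]: "val_ge v N 0"
  by (simp add: val_ge_def)

lemma val_ge_add: "val_ge v N a \<Longrightarrow> val_ge v N b \<Longrightarrow> val_ge v N (a + b)"
  using val_add[of a b] unfolding val_ge_def by (cases "a = 0"; cases "b = 0") force+

lemma val_ge_uminus [simp]: "val_ge v N (- a) \<longleftrightarrow> val_ge v N a"
  by (simp add: val_ge_def)

lemma val_ge_diff: "val_ge v N a \<Longrightarrow> val_ge v N b \<Longrightarrow> val_ge v N (a - b)"
  using val_ge_add[of N a "- b"] by simp

lemma val_ge_mult: "val_ge v M a \<Longrightarrow> val_ge v N b \<Longrightarrow> val_ge v (M + N) (a * b)"
  unfolding val_ge_def by (cases "a = 0"; cases "b = 0") (auto simp: val_mult)

lemma val_ge_mono: "val_ge v N a \<Longrightarrow> M \<le> N \<Longrightarrow> val_ge v M a"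
  by (auto simp: val_ge_def)

lemma val_ge_self: "val_ge v (v a) a"
  by (simp add: val_ge_def)

lemma integers_0 [simp]: "0 \<in> integer_ring v"
  by (simp add: integer_ring_def)

lemma integers_1 [simp]: "1 \<in> integer_ring v"
  by (simp add: integer_ring_def val_ge_def)

lemma integers_p [simp]: "of_nat p \<in> integer_ring v"
  by (simp add: integer_ring_def val_ge_def)

lemma integers_add: "a \<in> integer_ring v \<Longrightarrow> b \<in> integer_ring v \<Longrightarrow> a + b \<in> integer_ring v"
  by (simp add: integer_ring_def val_ge_add)

lemma integers_uminus: "a \<in> integer_ring v \<Longrightarrow> - a \<in> integer_ring v"
  by (simp add: integer_ring_def)

lemma integers_mult: "a \<in> integer_ring v \<Longrightarrow> b \<in> integer_ring v \<Longrightarrow> a * b \<in> integer_ring v"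
  using val_ge_mult[of 0 a 0 b] by (simp add: integer_ring_def)

lemma integersI: "0 \<le> v a \<Longrightarrow> a \<in> integer_ring v"
  by (simp add: integer_ring_def val_ge_def)

lemma integers_iff: "a \<in> integer_ring v \<longleftrightarrow> a = 0 \<or> 0 \<le> v a"
  by (simp add: integer_ring_def val_ge_def)

lemma integers_divide: "a \<noteq> 0 \<Longrightarrow> b = 0 \<or> v a \<le> v b \<Longrightarrow> b / a \<in> integer_ring v"
  by (cases "b = 0") (auto simp: integers_iff v_divide)

section \<open>The closure of the rationals is topologically closed and stable under ring
  operations\<close>

lemma rat_closure_closed:
  assumes "\<And>N. \<exists>b\<in>rat_closure v. val_ge v N (a - b)"
  shows "a \<in> rat_closure v"
  unfolding rat_closure_def
proof safe
  fix N
  obtain b where b: "b \<in> rat_closure v" "val_ge v N (a - b)"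
    using assms by blast
  then obtain q where "q \<in> \<rat>" "val_ge v N (b - q)"
    unfolding rat_closure_def by blast
  with val_ge_add[OF b(2) this(2)] show "\<exists>q\<in>\<rat>. val_ge v N (a - q)" by auto
qed

lemma Rats_subset_rat_closure: "q \<in> \<rat> \<Longrightarrow> q \<in> rat_closure v"
  unfolding rat_closure_def by (auto intro!: bexI[of _ q])

lemma rat_closure_add:
  assumes "a \<in> rat_closure v" "b \<in> rat_closure v"
  shows "a + b \<in> rat_closure v"
  unfolding rat_closure_def
proof safe
  fix N
  obtain q r where "q \<in> \<rat>" "val_ge v N (a - q)" "r \<in> \<rat>" "val_ge v N (b - r)"
    using assms unfolding rat_closure_def by blast
  then show "\<exists>q\<in>\<rat>. val_ge v N (a + b - q)"
    using val_ge_add[of N "a - q" "b - r"] by (intro bexI[of _ "q + r"]) (auto simp: algebra_simps)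
qed

lemma rat_closure_mult:
  assumes "a \<in> rat_closure v" "b \<in> rat_closure v"
  shows "a * b \<in> rat_closure v"
  unfolding rat_closure_def
proof safe
  fix N
  \<comment> \<open>The precisions come from
    \<open>a * b - q * r = a * (b - r) + r * (a - q)\<close>: \<open>r\<close> is chosen first,
    relative to \<open>v a\<close>, and \<open>q\<close> afterwards, relative to \<open>v r\<close>.
    If \<open>a\<close> or \<open>r\<close> is 0, the arbitrary value of \<open>v 0\<close> does no
    harm, as the corresponding product vanishes.\<close>
  obtain r where r: "r \<in> \<rat>" "val_ge v (N - v a) (b - r)"
    using assms(2) unfolding rat_closure_def by blast
  obtain q where q: "q \<in> \<rat>" "val_ge v (N - v r) (a - q)"
    using assms(1) unfolding rat_closure_def by blast
  have "val_ge v N (a * (b - r))" "val_ge v N (r * (a - q))"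
    using val_ge_mult[OF val_ge_self[of a] r(2)] val_ge_mult[OF val_ge_self[of r] q(2)] by auto
  from val_ge_add[OF this] have "val_ge v N (a * b - q * r)"
    by (simp add: algebra_simps)
  then show "\<exists>q\<in>\<rat>. val_ge v N (a * b - q)"
    using q r by (intro bexI[of _ "q * r"]) auto
qed

section \<open>The conjugation as an involution with the expected fixed field\<close>

lemma conj_Rats [simp]: "q \<in> \<rat> \<Longrightarrow> \<sigma> q = q"
  by (intro conj_base Rats_subset_rat_closure)

lemma conj_0 [simp]: "\<sigma> 0 = 0" and conj_1 [simp]: "\<sigma> 1 = 1"
  by simp_all

lemma conj_eq_0_iff [simp]: "\<sigma> a = 0 \<longleftrightarrow> a = 0"
  using conj_mult[of a "inverse a"] by (cases "a = 0") auto

lemma conj_uminus: "\<sigma> (- a) = - \<sigma> a"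
  using conj_add[of a "- a"] by (simp add: eq_neg_iff_add_eq_0 add.commute)

lemma conj_diff: "\<sigma> (a - b) = \<sigma> a - \<sigma> b"
  using conj_add[of a "- b"] by (simp add: conj_uminus)

lemma conj_divide: "\<sigma> (a / b) = \<sigma> a / \<sigma> b"
  using conj_mult[of "a / b" b] by (cases "b = 0") (auto simp: field_simps)

lemma conj_p_powi [simp]: "\<sigma> (of_nat p powi k) = of_nat p powi k"
  by (intro conj_Rats) (simp add: power_int_def)

text \<open>The generator \<open>\<theta>\<close> satisfies a monic quadratic equation over the base
  field, and \<open>\<sigma> \<theta>\<close>, being different from \<open>\<theta>\<close>, is its
  other root \<open>c - \<theta>\<close>. So \<open>\<sigma>\<close> exchanges the two roots, and a
  fixed element \<open>b + c * \<theta>\<close> must have \<open>c = 0\<close>.\<close>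

lemma conj_conj [simp]: "\<sigma> (\<sigma> a) = a"
  and conj_fixed: "\<sigma> a = a \<Longrightarrow> a \<in> rat_closure v"
proof -
  obtain \<theta> where \<theta>: "\<And>a. \<exists>b\<in>rat_closure v. \<exists>c\<in>rat_closure v. a = b + c * \<theta>"
    using degree_2 by blast
  have ne: "\<sigma> \<theta> \<noteq> \<theta>"
  proof
    assume eq: "\<sigma> \<theta> = \<theta>"
    have "\<sigma> a = a" for a
      using \<theta>[of a] eq by (auto simp: conj_add conj_mult conj_base)
    with conj_nontrivial show False by blast
  qed
  obtain b c where bc: "b \<in> rat_closure v" "c \<in> rat_closure v" "\<theta> * \<theta> = b + c * \<theta>"
    using \<theta> by blast
  have "\<sigma> \<theta> * \<sigma> \<theta> = b + c * \<sigma> \<theta>"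
    using arg_cong[OF bc(3), of \<sigma>] bc(1,2) by (simp add: conj_add conj_mult conj_base)
  with bc(3) have "(\<sigma> \<theta> - \<theta>) * (\<sigma> \<theta> + \<theta> - c) = 0"
    by (simp add: algebra_simps)
  with ne have "\<sigma> \<theta> + \<theta> - c = 0"
    by (metis mult_eq_0_iff right_minus_eq)
  then have sth: "\<sigma> \<theta> = c - \<theta>"
    by (simp add: eq_diff_eq)
  then have "\<sigma> (\<sigma> \<theta>) = \<theta>"
    using bc by (simp add: conj_diff conj_base)
  then show "\<sigma> (\<sigma> a) = a"
    using \<theta>[of a] by (auto simp: conj_add conj_mult conj_base)
  show "a \<in> rat_closure v" if "\<sigma> a = a"
  proof -
    obtain b c where bc: "b \<in> rat_closure v" "c \<in> rat_closure v" "a = b + c * \<theta>"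
      using \<theta> by blast
    with that have "c * (\<sigma> \<theta> - \<theta>) = 0"
      by (simp add: conj_add conj_mult conj_base algebra_simps)
    with ne bc show ?thesis by simp
  qed
qed

text \<open>If \<open>v (\<sigma> a) < 0 \<le> v a\<close>, then \<open>e = a / (a + \<sigma> a)\<close> has positive valuation and satisfies
  \<open>e = e\<^sup>2 + e \<cdot> \<sigma> e\<close> with \<open>e \<cdot> \<sigma> e\<close> in the base field. Iterating \<open>u \<mapsto> u\<^sup>2 + e \<cdot> \<sigma> e\<close>
  approximates \<open>e\<close> inside the base field, so \<open>\<sigma> e = e\<close>, which contradicts \<open>v (\<sigma> a) < v a\<close>.\<close>

lemma integers_conj:
  assumes "a \<in> integer_ring v"
  shows "\<sigma> a \<in> integer_ring v"
proof (rule ccontr)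
  assume *: "\<sigma> a \<notin> integer_ring v"
  then have a0: "a \<noteq> 0" and neg: "v (\<sigma> a) < 0"
    by (auto simp: integers_iff)
  have va: "0 \<le> v a"
    using assms a0 by (simp add: integers_iff)
  define t where "t = a + \<sigma> a"
  have t0: "t \<noteq> 0"
    using neg va v_uminus[of a] unfolding t_def by (metis add_eq_0_iff leD)
  \<comment> \<open>If \<open>t\<close> had valuation above \<open>v (\<sigma> a)\<close>, then so
    would \<open>\<sigma> a = t - a\<close>, because \<open>v a\<close> is nonnegative and
    \<open>v (\<sigma> a)\<close> is negative. This is absurd, so
    \<open>v t \<le> v (\<sigma> a) < 0\<close>.\<close>
  have "val_ge v (v (\<sigma> a) + 1) t \<Longrightarrow> val_ge v (v (\<sigma> a) + 1) (t - a)"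
    using va neg a0 by (intro val_ge_diff) (auto simp: val_ge_def)
  then have vt: "v t < 0"
    using t0 a0 neg by (fastforce simp: t_def val_ge_def)
  define e where "e = a / t"
  have e0: "e \<noteq> 0" using a0 t0 by (simp add: e_def)
  have ve: "val_ge v 1 e"
    using vt va a0 t0 by (simp add: e_def val_ge_def v_divide)
  have "\<sigma> t = t"
    by (simp add: t_def conj_add add.commute)
  then have se: "\<sigma> e = 1 - e"
    using t0 by (simp add: e_def conj_divide field_simps) (simp add: t_def)
  define n where "n = e * \<sigma> e"
  have nF: "n \<in> rat_closure v"
    by (rule conj_fixed) (simp add: n_def conj_mult mult.commute)
  define u where "u = (\<lambda>k::nat. ((\<lambda>w. w * w + n) ^^ k) 0)"
  have u_Suc: "u (Suc k) = u k * u k + n" for k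
    by (simp add: u_def)
  have uF: "u k \<in> rat_closure v" for k
  proof (induction k)
    case 0
    show ?case by (simp add: u_def Rats_subset_rat_closure)
  next
    case (Suc k)
    then show ?case by (simp add: u_Suc rat_closure_add rat_closure_mult nF)
  qed
  have "val_ge v (int k + 1) (e - u k)" for k
  proof (induction k)
    case 0
    show ?case using ve by (simp add: u_def)
  next
    case (Suc k)
    \<comment> \<open>Since \<open>e + u k = 2e - (e - u k)\<close> has positive valuation, the
      factorization of \<open>e - u (Suc k)\<close> gains at least one power of \<open>p\<close> in
      each iteration.\<close>
    have "val_ge v 1 (e - u k)"
      using Suc by (rule val_ge_mono) simp
    from val_ge_diff[OF val_ge_add[OF ve ve] this] have "val_ge v 1 (e + u k)"
      by simp
    from val_ge_mult[OF Suc this] have "val_ge v (int (Suc k) + 1) ((e - u k) * (e + u k))"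
      by (simp add: algebra_simps)
    moreover have "e - u (Suc k) = (e - u k) * (e + u k)"
      by (simp add: u_Suc n_def se algebra_simps)
    ultimately show ?case by simp
  qed
  then have "val_ge v N (e - u (nat N))" for N
    by (rule val_ge_mono) simp
  then have "e \<in> rat_closure v"
    using uF by (intro rat_closure_closed) blast
  then have "\<sigma> e = e" by (rule conj_base)
  then have "\<sigma> a = a"
    using t0 \<open>\<sigma> t = t\<close> by (simp add: e_def conj_divide)
  with * assms show False by simp
qed

end

section \<open>Lattices and biduality\<close>

context hermitian_space
begin

section \<open>Sesquilinearity of the form\<close>

lemma form_0_left [simp]: "h 0 y = 0"
  using form_scale[of 0 0 y] by simp

lemma form_0_right [simp]: "h x 0 = 0"
  using form_conj[of 0 x] by simp

lemma form_uminus_left [simp]: "h (- x) y = - h x y"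
  using form_scale[of "-1" x y] by simp

lemma form_diff_left: "h (x - z) y = h x y - h z y"
  using form_add[of x "- z" y] by simp

lemma form_sum_left: "h (\<Sum>i\<in>I. f i) y = (\<Sum>i\<in>I. h (f i) y)"
  by (induction I rule: infinite_finite_induct) (auto simp: form_add)

lemma form_add_right: "h x (y + z) = h x y + h x z"
  by (metis form_conj form_add conj_add)

lemma form_scale_right: "h x (scale a y) = \<sigma> a * h x y"
  by (metis form_conj form_scale conj_mult)

lemma form_integers_sym: "h x y \<in> integer_ring v \<longleftrightarrow> h y x \<in> integer_ring v"
  by (metis form_conj integers_conj)

lemma form_eq_0_sym: "h x y = 0 \<longleftrightarrow> h y x = 0"
  by (metis form_conj conj_0)

definition nondegenerate_subspace :: "'c set \<Rightarrow> bool" where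
  "nondegenerate_subspace W \<longleftrightarrow> subspace W \<and> (\<forall>z\<in>W. (\<forall>w\<in>W. h z w = 0) \<longrightarrow> z = 0)"

section \<open>Modules over the ring of integers and their generators\<close>

definition integral_submodule :: "'c set \<Rightarrow> bool" where
  "integral_submodule N \<longleftrightarrow> 0 \<in> N \<and> (\<forall>x\<in>N. \<forall>y\<in>N. x + y \<in> N) \<and>
     (\<forall>a\<in>integer_ring v. \<forall>x\<in>N. scale a x \<in> N)"

lemma integral_submodule_sum:
  assumes "integral_submodule N" "\<And>i. i \<in> I \<Longrightarrow> f i \<in> N"
  shows "(\<Sum>i\<in>I. f i) \<in> N"
  using assms(2)
  by (induction I rule: infinite_finite_induct) (use assms(1) in \<open>auto simp: integral_submodule_def\<close>)

lemma integral_submodule_span: "integral_submodule (integral_span v scale B)"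
  unfolding integral_submodule_def
proof (intro conjI ballI)
  show "0 \<in> integral_span v scale B"
    unfolding integral_span_def by (auto intro!: exI[of _ "\<lambda>_. 0"])
next
  fix x y assume "x \<in> integral_span v scale B" "y \<in> integral_span v scale B"
  then obtain c d where
    "x = (\<Sum>b\<in>B. scale (c b) b)" "\<forall>b\<in>B. c b \<in> integer_ring v"
    "y = (\<Sum>b\<in>B. scale (d b) b)" "\<forall>b\<in>B. d b \<in> integer_ring v"
    unfolding integral_span_def by blast
  then show "x + y \<in> integral_span v scale B"
    unfolding integral_span_def
    by (auto intro!: exI[of _ "\<lambda>b. c b + d b"] simp: scale_left_distrib sum.distrib integers_add)
next
  fix a x assume "a \<in> integer_ring v" "x \<in> integral_span v scale B"
  moreover from this obtain c where
    "x = (\<Sum>b\<in>B. scale (c b) b)" "\<forall>b\<in>B. c b \<in> integer_ring v"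
    unfolding integral_span_def by blast
  ultimately show "scale a x \<in> integral_span v scale B"
    unfolding integral_span_def
    by (auto intro!: exI[of _ "\<lambda>b. a * c b"] simp: scale_sum_right integers_mult)
qed

lemma integral_span_superset:
  assumes "finite B" "b \<in> B"
  shows "b \<in> integral_span v scale B"
proof -
  have "(\<Sum>b'\<in>B. scale (if b' = b then 1 else 0) b') = (\<Sum>b'\<in>B. if b' = b then b else 0)"
    by (intro sum.cong) auto
  also have "\<dots> = b"
    using assms by simp
  finally show ?thesis
    unfolding integral_span_def
    by (intro CollectI exI[of _ "\<lambda>b'. if b' = b then 1 else 0"]) auto
qed

lemma integral_span_minimal:
  assumes "integral_submodule N" "B \<subseteq> N"
  shows "integral_span v scale B \<subseteq> N"
proof
  fix x assume "x \<in> integral_span v scale B"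
  then obtain c where c: "x = (\<Sum>b\<in>B. scale (c b) b)" "\<forall>b\<in>B. c b \<in> integer_ring v"
    unfolding integral_span_def by blast
  show "x \<in> N"
    unfolding c(1) using assms c(2)
    by (intro integral_submodule_sum) (auto simp: integral_submodule_def)
qed

lemma integral_submodule_subspace: "subspace W \<Longrightarrow> integral_submodule W"
  by (auto simp: integral_submodule_def subspace_def)

lemma span_integral_span:
  assumes "finite B"
  shows "span (integral_span v scale B) = span B"
proof (rule span_eq[THEN iffD2], intro conjI)
  show "integral_span v scale B \<subseteq> span B"
    by (intro integral_span_minimal integral_submodule_subspace subspace_span span_superset)
  show "B \<subseteq> span (integral_span v scale B)"
    using integral_span_superset[OF assms] span_superset by blast
qed

lemma is_latticeE:
  assumes "is_lattice v scale W \<Lambda>"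
  obtains B where "finite B" "\<Lambda> = integral_span v scale B" "span B = W"
  using assms span_integral_span unfolding is_lattice_def by metis

lemma is_latticeI: "finite B \<Longrightarrow> span B = W \<Longrightarrow> is_lattice v scale W (integral_span v scale B)"
  using span_integral_span unfolding is_lattice_def by metis

lemma is_lattice_submodule: "is_lattice v scale W \<Lambda> \<Longrightarrow> integral_submodule \<Lambda>"
  using integral_submodule_span by (auto elim: is_latticeE)

lemma is_lattice_subset: "is_lattice v scale W \<Lambda> \<Longrightarrow> \<Lambda> \<subseteq> W"
  using span_superset unfolding is_lattice_def by blast

lemma is_lattice_subspace: "is_lattice v scale W \<Lambda> \<Longrightarrow> subspace W"
  using subspace_span unfolding is_lattice_def by blast

lemma lattice_basis:
  assumes "finite B"
  shows "\<exists>B'. finite B' \<and> independent B' \<and> integral_span v scale B' = integral_span v scale B"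
  using assms
proof (induction "card B" arbitrary: B rule: less_induct)
  case less
  show ?case
  proof (cases "independent B")
    case False
    then obtain u where u: "\<exists>b\<in>B. u b \<noteq> 0" "(\<Sum>b\<in>B. scale (u b) b) = 0"
      using dependent_finite[OF less.prems] by blast
    \<comment> \<open>Zero coefficients are excluded from the minimum because \<open>v 0\<close>
      carries no information.\<close>
    define V where "V = {b\<in>B. u b \<noteq> 0}"
    have "finite ((\<lambda>b. v (u b)) ` V)" "(\<lambda>b. v (u b)) ` V \<noteq> {}"
      using u less.prems by (auto simp: V_def)
    from Min_in[OF this] Min_le[OF this(1)]
    obtain b0 where b0: "b0 \<in> V" "\<And>b. b \<in> V \<Longrightarrow> v (u b0) \<le> v (u b)"
      by (smt (verit) imageE imageI)
    then have b0': "b0 \<in> B" "u b0 \<noteq> 0" by (auto simp: V_def)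
    define B1 where "B1 = B - {b0}"
    have fB1: "finite B1" using less.prems by (simp add: B1_def)
    have "scale (u b0) b0 = - (\<Sum>b\<in>B1. scale (u b) b)"
      using u(2) sum.remove[OF less.prems b0'(1), of "\<lambda>b. scale (u b) b"]
      by (simp add: B1_def eq_neg_iff_add_eq_0)
    then have "scale (inverse (u b0)) (scale (u b0) b0) =
        scale (inverse (u b0)) (- (\<Sum>b\<in>B1. scale (u b) b))" by simp
    then have "b0 = (\<Sum>b\<in>B1. scale (- (u b / u b0)) b)"
      using b0' by (simp add: scale_sum_right divide_inverse mult.commute sum_negf)
    moreover have "- (u b / u b0) \<in> integer_ring v" if "b \<in> B1" for b
    proof -
      have "u b = 0 \<or> v (u b0) \<le> v (u b)"
        using b0(2)[of b] that by (auto simp: V_def B1_def)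
      then show ?thesis
        using b0' integers_divide integers_uminus by blast
    qed
    ultimately have "b0 \<in> integral_span v scale B1"
      unfolding integral_span_def
      by (intro CollectI exI[of _ "\<lambda>b. - (u b / u b0)"]) simp
    then have "integral_span v scale B \<subseteq> integral_span v scale B1"
      using integral_span_superset[OF fB1]
      by (intro integral_span_minimal integral_submodule_span) (auto simp: B1_def)
    moreover have "integral_span v scale B1 \<subseteq> integral_span v scale B"
      using integral_span_superset[OF less.prems]
      by (intro integral_span_minimal integral_submodule_span) (auto simp: B1_def)
    moreover have "card B1 < card B"
      unfolding B1_def using less.prems b0'(1) by (rule card_Diff1_less)
    ultimately show ?thesis
      using less.hyps[OF _ fB1] by auto
  qed (use less.prems in blast)
qed

text \<open>This is the fact that a linear functional vanishing on the common kernel of finitely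
  many functionals is a combination of them. The induction removes one functional by passing to its
  kernel \<open>W1\<close> inside \<open>W\<close>, so \<open>W\<close> has to vary.\<close>

lemma form_combination:
  assumes "finite B" "subspace W"
    and "\<And>w. w \<in> W \<Longrightarrow> (\<And>b. b \<in> B \<Longrightarrow> h w b = 0) \<Longrightarrow> h w z = 0"
  shows "\<exists>c. \<forall>w\<in>W. h w z = (\<Sum>b\<in>B. c b * h w b)"
  using assms
proof (induction B arbitrary: W rule: finite_induct)
  case empty
  then show ?case by auto
next
  case (insert b B)
  define W1 where "W1 = {w\<in>W. h w b = 0}"
  have "subspace W1"
    using insert.prems(1) by (auto simp: subspace_def W1_def form_add form_scale)
  moreover have "h w z = 0" if "w \<in> W1" "\<And>b. b \<in> B \<Longrightarrow> h w b = 0" for w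
    using insert.prems(2)[of w] that by (auto simp: W1_def)
  ultimately obtain c where c: "\<And>w. w \<in> W1 \<Longrightarrow> h w z = (\<Sum>b\<in>B. c b * h w b)"
    using insert.IH by blast
  have sum_upd: "(\<Sum>b'\<in>insert b B. (c(b := d)) b' * h w b') = d * h w b + (\<Sum>b\<in>B. c b * h w b)"
    for d w
  proof -
    have "(\<Sum>b'\<in>B. (c(b := d)) b' * h w b') = (\<Sum>b\<in>B. c b * h w b)"
      using insert.hyps by (intro sum.cong) auto
    then show ?thesis using insert.hyps by simp
  qed
  show ?case
  proof (cases "W1 = W")
    case True
    then have "h w z = (\<Sum>b'\<in>insert b B. (c(b := 0)) b' * h w b')" if "w \<in> W" for w
      using c that by (simp only: sum_upd) simp
    then show ?thesis by blast
  next
    case False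
    then obtain w1 where w1: "w1 \<in> W" "h w1 b \<noteq> 0"
      by (auto simp: W1_def)
    \<comment> \<open>The new coefficient is forced by evaluation at \<open>w1\<close>. Every
      \<open>w\<close> in \<open>W\<close> differs from a multiple of \<open>w1\<close> by an
      element of \<open>W1\<close>, so the formula then holds on all of \<open>W\<close>.\<close>
    define d where "d = (h w1 z - (\<Sum>b\<in>B. c b * h w1 b)) / h w1 b"
    have "h w z = (\<Sum>b'\<in>insert b B. (c(b := d)) b' * h w b')" if w: "w \<in> W" for w
    proof -
      define q where "q = h w b / h w1 b"
      have "w - scale q w1 \<in> W1"
        using w w1 insert.prems(1)
        by (auto simp: W1_def q_def form_diff_left form_scale subspace_diff subspace_scale)
      from c[OF this] have "h w z - q * h w1 z = (\<Sum>b\<in>B. c b * (h w b - q * h w1 b))"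
        by (simp add: form_diff_left form_scale)
      also have "\<dots> = (\<Sum>b\<in>B. c b * h w b) - q * (\<Sum>b\<in>B. c b * h w1 b)"
        by (simp add: algebra_simps sum_subtractf sum_distrib_left)
      finally have "h w z = q * (h w1 z - (\<Sum>b\<in>B. c b * h w1 b)) + (\<Sum>b\<in>B. c b * h w b)"
        by (simp add: algebra_simps)
      also have "q * (h w1 z - (\<Sum>b\<in>B. c b * h w1 b)) = d * h w b"
        using w1 by (simp add: q_def d_def)
      finally show ?thesis by (simp only: sum_upd)
    qed
    then show ?thesis by blast
  qed
qed

text \<open>If every vector of \<open>W\<close> orthogonal to the other members of \<open>B\<close>
  were orthogonal to \<open>b0\<close> as well, then pairing with \<open>b0\<close> would be a
  combination of the pairings with the others. Nondegeneracy would turn this into a linear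
  dependence of \<open>b0\<close> on them.\<close>

lemma dual_vector_exists:
  assumes W: "nondegenerate_subspace W"
    and B: "finite B" "independent B" "B \<subseteq> W" "b0 \<in> B"
  shows "\<exists>w\<in>W. h b0 w = 1 \<and> (\<forall>b\<in>B - {b0}. h b w = 0)"
proof -
  have "\<exists>w\<in>W. (\<forall>b\<in>B - {b0}. h w b = 0) \<and> h w b0 \<noteq> 0"
  proof (rule ccontr)
    assume "\<not> ?thesis"
    then have "\<And>w. w \<in> W \<Longrightarrow> (\<And>b. b \<in> B - {b0} \<Longrightarrow> h w b = 0) \<Longrightarrow> h w b0 = 0"
      by blast
    from form_combination[OF _ _ this]
    obtain c where c: "\<forall>w\<in>W. h w b0 = (\<Sum>b\<in>B - {b0}. c b * h w b)"
      using B(1) W unfolding nondegenerate_subspace_def by blast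
    \<comment> \<open>The coefficients are conjugated because the form is conjugate-linear in its
      second argument, where \<open>b0\<close> occurs in \<open>c\<close>.\<close>
    define z where "z = (\<Sum>b\<in>B - {b0}. scale (\<sigma> (c b)) b)"
    have zspan: "z \<in> span (B - {b0})"
      unfolding z_def by (intro span_sum span_scale span_base)
    have "span (B - {b0}) \<subseteq> W"
      using B W by (intro span_minimal) (auto simp: nondegenerate_subspace_def)
    with zspan have zW: "b0 - z \<in> W"
      using B W by (auto simp: nondegenerate_subspace_def intro!: subspace_diff)
    have hz: "h (b0 - z) w = 0" if "w \<in> W" for w
    proof -
      have "h z w = (\<Sum>b\<in>B - {b0}. \<sigma> (c b * h w b))"
        by (simp add: z_def form_sum_left form_scale conj_mult form_conj[of _ w, symmetric])
      also have "\<dots> = \<sigma> (\<Sum>b\<in>B - {b0}. c b * h w b)"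
        using B(1) by (induction B rule: finite_induct) (auto simp: conj_add insert_Diff_if)
      also have "\<dots> = h b0 w"
        using c that by (metis form_conj)
      finally show ?thesis by (simp add: form_diff_left)
    qed
    from W zW hz have "b0 - z = 0"
      unfolding nondegenerate_subspace_def by blast
    with zspan have "b0 \<in> span (B - {b0})" by simp
    with B(2,4) show False unfolding dependent_def by blast
  qed
  then obtain w where w: "w \<in> W" "\<forall>b\<in>B - {b0}. h w b = 0" "h w b0 \<noteq> 0" by blast
  have "h b0 w \<noteq> 0" using w(3) form_eq_0_sym by blast
  moreover have "\<forall>b\<in>B - {b0}. h b w = 0" using w(2) form_eq_0_sym by blast
  \<comment> \<open>The same conjugate-linearity makes \<open>\<sigma> (inverse (h b0 w))\<close>
    the factor that normalizes the pairing to 1.\<close>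
  ultimately show ?thesis
    using w W
    by (intro bexI[of _ "scale (\<sigma> (inverse (h b0 w))) w"])
       (auto simp: form_scale_right nondegenerate_subspace_def subspace_scale)
qed

text \<open>Coordinates with respect to an integral basis are pairings with dual vectors. These dual
  vectors lie in the dual lattice, so an element of the bidual has integral coordinates.\<close>

lemma dual_dual_subset:
  assumes W: "nondegenerate_subspace W" and \<Lambda>: "is_lattice v scale W \<Lambda>"
  shows "dual v h W (dual v h W \<Lambda>) \<subseteq> \<Lambda>"
proof
  fix z assume z: "z \<in> dual v h W (dual v h W \<Lambda>)"
  obtain B0 where B0: "finite B0" "\<Lambda> = integral_span v scale B0" "span B0 = W"
    using \<Lambda> by (rule is_latticeE)
  obtain B where B: "finite B" "independent B" "\<Lambda> = integral_span v scale B"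
    using lattice_basis[OF B0(1)] B0(2) by auto
  have spanB: "span B = W"
    using B0 B span_integral_span by metis
  have BW: "B \<subseteq> W"
    using span_superset spanB by blast
  have "z \<in> span B" using z spanB by (simp add: dual_def)
  then obtain c where c: "z = (\<Sum>b\<in>B. scale (c b) b)"
    using span_finite[OF B(1)] by auto
  have "c b0 \<in> integer_ring v" if b0: "b0 \<in> B" for b0
  proof -
    obtain w where w: "w \<in> W" "h b0 w = 1" "\<forall>b\<in>B - {b0}. h b w = 0"
      using dual_vector_exists[OF W B(1,2) BW b0] by blast
    have coeff: "h (\<Sum>b\<in>B. scale (d b) b) w = d b0" for d
    proof -
      have "h (\<Sum>b\<in>B. scale (d b) b) w = (\<Sum>b\<in>B. if b = b0 then d b0 else 0)"
        unfolding form_sum_left form_scale using w by (intro sum.cong) auto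
      then show ?thesis using B(1) b0 by simp
    qed
    have "h y w \<in> integer_ring v" if "y \<in> \<Lambda>" for y
      using that coeff b0 unfolding B(3) integral_span_def by auto
    then have "w \<in> dual v h W \<Lambda>"
      using w(1) by (simp add: dual_def form_integers_sym[of w])
    then show ?thesis
      using z coeff[of c] by (auto simp: dual_def c)
  qed
  then show "z \<in> \<Lambda>"
    unfolding B(3) integral_span_def c by blast
qed

section \<open>Vertex lattices\<close>

abbreviation vertices :: "'c set \<Rightarrow> 'c set set" where
  "vertices W \<equiv> vertex_lattices p v scale h W"

lemma vertices_lattice: "\<Lambda> \<in> vertices W \<Longrightarrow> is_lattice v scale W \<Lambda>"
  and vertices_p_dual: "\<Lambda> \<in> vertices W \<Longrightarrow> z \<in> \<Lambda> \<Longrightarrow> scale (of_nat p) z \<in> dual v h W \<Lambda>"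
  and vertices_dual: "\<Lambda> \<in> vertices W \<Longrightarrow> dual v h W \<Lambda> \<subseteq> \<Lambda>"
  by (auto simp: vertex_lattices_def)

lemma verticesI:
  assumes "is_lattice v scale W \<Lambda>"
    and "\<And>z. z \<in> \<Lambda> \<Longrightarrow> scale (of_nat p) z \<in> dual v h W \<Lambda>"
    and "dual v h W \<Lambda> \<subseteq> \<Lambda>"
  shows "\<Lambda> \<in> vertices W"
  using assms by (auto simp: vertex_lattices_def)

lemma dualI:
  "y \<in> W \<Longrightarrow> (\<And>z. z \<in> \<Lambda> \<Longrightarrow> h y z \<in> integer_ring v) \<Longrightarrow> y \<in> dual v h W \<Lambda>"
  by (simp add: dual_def)

lemma dual_form: "y \<in> dual v h W \<Lambda> \<Longrightarrow> z \<in> \<Lambda> \<Longrightarrow> h y z \<in> integer_ring v"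
  by (simp add: dual_def)

lemma dual_antimono: "\<Lambda> \<subseteq> \<Lambda>' \<Longrightarrow> dual v h W \<Lambda>' \<subseteq> dual v h W \<Lambda>"
  by (auto simp: dual_def)

lemma integral_submodule_dual: "subspace W \<Longrightarrow> integral_submodule (dual v h W \<Lambda>)"
  by (auto simp: integral_submodule_def dual_def subspace_def form_add form_scale
      integers_add integers_mult)

section \<open>Enlarging vertex lattices by adjoining vectors\<close>

lemma is_lattice_adjoin:
  assumes "is_lattice v scale W \<Lambda>" "w \<in> W"
  shows "\<exists>\<Lambda>'. is_lattice v scale W \<Lambda>' \<and> \<Lambda> \<subseteq> \<Lambda>' \<and> w \<in> \<Lambda>' \<and>
    (\<forall>z\<in>\<Lambda>'. \<exists>y\<in>\<Lambda>. \<exists>a\<in>integer_ring v. z = y + scale a w)"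
proof -
  obtain B where B: "finite B" "\<Lambda> = integral_span v scale B" "span B = W"
    using assms(1) by (rule is_latticeE)
  define \<Lambda>' where "\<Lambda>' = integral_span v scale (insert w B)"
  have fin: "finite (insert w B)" using B by simp
  have sub: "insert w B \<subseteq> \<Lambda>'"
    using integral_span_superset[OF fin] by (auto simp: \<Lambda>'_def)
  have "span (insert w B) = W"
    using B(3) assms(2) by (simp add: span_redundant)
  then have "is_lattice v scale W \<Lambda>'"
    unfolding \<Lambda>'_def by (rule is_latticeI[OF fin])
  moreover have "\<Lambda> \<subseteq> \<Lambda>'"
    unfolding B(2) using sub
    by (intro integral_span_minimal) (auto simp: \<Lambda>'_def integral_submodule_span)
  \<comment> \<open>\<open>N\<close> is the sum of \<open>\<Lambda>\<close> and the integral
    multiples of \<open>w\<close>. It is a module containing all generators of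
    \<open>\<Lambda>'\<close>, which gives the decomposition claimed last.\<close>
  moreover define N where "N = {y + scale a w | y a. y \<in> \<Lambda> \<and> a \<in> integer_ring v}"
  have \<Lambda>: "integral_submodule \<Lambda>" by (rule is_lattice_submodule[OF assms(1)])
  have "integral_submodule N"
    unfolding integral_submodule_def
  proof (intro conjI ballI)
    show "0 \<in> N"
      unfolding N_def using \<Lambda> by (auto simp: integral_submodule_def intro!: exI[of _ 0])
  next
    fix x y assume "x \<in> N" "y \<in> N"
    then obtain x' a y' b where "x = x' + scale a w" "y = y' + scale b w"
      "x' \<in> \<Lambda>" "y' \<in> \<Lambda>" "a \<in> integer_ring v" "b \<in> integer_ring v"
      unfolding N_def by blast
    then show "x + y \<in> N"
      unfolding N_def using \<Lambda>
      by (intro CollectI exI[of _ "x' + y'"] exI[of _ "a + b"])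
         (auto simp: integral_submodule_def integers_add scale_left_distrib algebra_simps)
  next
    fix c x assume "c \<in> integer_ring v" "x \<in> N"
    moreover from this obtain x' a where "x = x' + scale a w" "x' \<in> \<Lambda>" "a \<in> integer_ring v"
      unfolding N_def by blast
    ultimately show "scale c x \<in> N"
      unfolding N_def using \<Lambda>
      by (intro CollectI exI[of _ "scale c x'"] exI[of _ "c * a"])
         (auto simp: integral_submodule_def integers_mult scale_right_distrib)
  qed
  moreover have "b \<in> N" if "b \<in> insert w B" for b
  proof (cases "b = w")
    case True
    then show ?thesis
      unfolding N_def using \<Lambda>
      by (intro CollectI exI[of _ 0] exI[of _ 1]) (auto simp: integral_submodule_def)
  next
    case False
    then have "b \<in> \<Lambda>" using that B integral_span_superset by auto
    then show ?thesis
      unfolding N_def by (intro CollectI exI[of _ b] exI[of _ 0]) auto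
  qed
  ultimately have "\<Lambda>' \<subseteq> N"
    unfolding \<Lambda>'_def by (intro integral_span_minimal) auto
  then have "\<forall>z\<in>\<Lambda>'. \<exists>y\<in>\<Lambda>. \<exists>a\<in>integer_ring v. z = y + scale a w"
    unfolding N_def by blast
  with \<open>is_lattice v scale W \<Lambda>'\<close> \<open>\<Lambda> \<subseteq> \<Lambda>'\<close> sub show ?thesis by blast
qed

text \<open>The inclusion of the dual is inherited, since the lattice grows and its dual shrinks.
  The other inclusion amounts to integrality of \<open>p\<close> times all pairings on
  \<open>\<Lambda>'\<close>, which the hypotheses on \<open>w\<close> provide. The final clause
  controls how much the dual shrinks, so that further vectors can be adjoined.\<close>

lemma vertices_adjoin:
  assumes \<Lambda>: "\<Lambda> \<in> vertices W"
    and w: "w \<in> W" "scale (of_nat p) w \<in> dual v h W \<Lambda>" "of_nat p * h w w \<in> integer_ring v"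
  shows "\<exists>\<Lambda>'\<in>vertices W. \<Lambda> \<subseteq> \<Lambda>' \<and> w \<in> \<Lambda>' \<and>
    (\<forall>u\<in>dual v h W \<Lambda>. h u w \<in> integer_ring v \<longrightarrow> u \<in> dual v h W \<Lambda>')"
proof -
  obtain \<Lambda>' where \<Lambda>': "is_lattice v scale W \<Lambda>'" "\<Lambda> \<subseteq> \<Lambda>'" "w \<in> \<Lambda>'"
    and split: "\<And>z. z \<in> \<Lambda>' \<Longrightarrow> \<exists>y\<in>\<Lambda>. \<exists>a\<in>integer_ring v. z = y + scale a w"
    using is_lattice_adjoin[OF vertices_lattice[OF \<Lambda>] w(1)] by blast
  have sub: "subspace W" by (rule is_lattice_subspace[OF \<Lambda>'(1)])
  have du: "u \<in> dual v h W \<Lambda>'" if u: "u \<in> dual v h W \<Lambda>" "h u w \<in> integer_ring v" for u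
  proof (rule dualI)
    show "u \<in> W" using u by (simp add: dual_def)
    fix z assume "z \<in> \<Lambda>'"
    then obtain y a where "y \<in> \<Lambda>" "a \<in> integer_ring v" "z = y + scale a w"
      using split by blast
    then show "h u z \<in> integer_ring v"
      using u dual_form[OF u(1)]
      by (auto simp: form_add_right form_scale_right integers_conj intro!: integers_add integers_mult)
  qed
  have "\<Lambda>' \<in> vertices W"
  proof (rule verticesI[OF \<Lambda>'(1)])
    show "dual v h W \<Lambda>' \<subseteq> \<Lambda>'"
      using dual_antimono[OF \<Lambda>'(2)] vertices_dual[OF \<Lambda>] \<Lambda>'(2) by blast
    fix z assume "z \<in> \<Lambda>'"
    then obtain y a where ya: "y \<in> \<Lambda>" "a \<in> integer_ring v" "z = y + scale a w"
      using split by blast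
    have "h (scale (of_nat p) w) y \<in> integer_ring v"
      using w(2) ya(1) by (rule dual_form)
    then have "h y (scale (of_nat p) w) \<in> integer_ring v"
      using form_integers_sym by blast
    then have "h (scale (of_nat p) y) w \<in> integer_ring v"
      by (simp add: form_scale form_scale_right)
    then have "scale (of_nat p) y \<in> dual v h W \<Lambda>'"
      by (intro du vertices_p_dual[OF \<Lambda> ya(1)])
    moreover have "scale (of_nat p) w \<in> dual v h W \<Lambda>'"
      using w by (intro du) (auto simp: form_scale)
    moreover have "scale (of_nat p) z = scale (of_nat p) y + scale a (scale (of_nat p) w)"
      by (simp add: ya(3) scale_right_distrib mult.commute)
    ultimately show "scale (of_nat p) z \<in> dual v h W \<Lambda>'"
      using integral_submodule_dual[OF sub, of \<Lambda>'] ya(2)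
      by (auto simp: integral_submodule_def simp del: scale_scale)
  qed
  with \<Lambda>' du show ?thesis by blast
qed

text \<open>The vectors are adjoined one at a time. The next \<open>p\<close>-multiple stays in the
  shrinking dual because it pairs integrally with the vectors adjoined before.\<close>

lemma vertices_enlarge:
  assumes "finite Y" "\<Lambda> \<in> vertices W" "Y \<subseteq> W"
    and "\<And>w. w \<in> Y \<Longrightarrow> scale (of_nat p) w \<in> dual v h W \<Lambda>"
    and "\<And>w w'. w \<in> Y \<Longrightarrow> w' \<in> Y \<Longrightarrow> of_nat p * h w w' \<in> integer_ring v"
  shows "\<exists>\<Lambda>'\<in>vertices W. \<Lambda> \<subseteq> \<Lambda>' \<and> Y \<subseteq> \<Lambda>' \<and>
    (\<forall>u\<in>dual v h W \<Lambda>. (\<forall>w\<in>Y. h u w \<in> integer_ring v) \<longrightarrow> u \<in> dual v h W \<Lambda>')"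
  using assms
proof (induction Y rule: finite_induct)
  case (insert w Y)
  then obtain \<Lambda>1 where \<Lambda>1: "\<Lambda>1 \<in> vertices W" "\<Lambda> \<subseteq> \<Lambda>1" "Y \<subseteq> \<Lambda>1"
    and du1: "\<And>u. u \<in> dual v h W \<Lambda> \<Longrightarrow> \<forall>w\<in>Y. h u w \<in> integer_ring v \<Longrightarrow> u \<in> dual v h W \<Lambda>1"
    by auto
  have "scale (of_nat p) w \<in> dual v h W \<Lambda>1"
    using insert.prems by (intro du1) (auto simp: form_scale)
  from vertices_adjoin[OF \<Lambda>1(1) _ this]
  obtain \<Lambda>2 where \<Lambda>2: "\<Lambda>2 \<in> vertices W" "\<Lambda>1 \<subseteq> \<Lambda>2" "w \<in> \<Lambda>2"
    and "\<forall>u\<in>dual v h W \<Lambda>1. h u w \<in> integer_ring v \<longrightarrow> u \<in> dual v h W \<Lambda>2"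
    using insert.prems by auto
  with \<Lambda>1 du1 show ?case
    by (intro bexI[of _ \<Lambda>2]) auto
qed auto

section \<open>Shrinking vertex lattices by integrality conditions\<close>

lemma is_lattice_restrict:
  assumes "is_lattice v scale W \<Lambda>"
  shows "is_lattice v scale W {z\<in>\<Lambda>. h z y \<in> integer_ring v}" (is "is_lattice v scale W ?N")
proof -
  obtain B where B: "finite B" "\<Lambda> = integral_span v scale B" "span B = W"
    using assms by (rule is_latticeE)
  have \<Lambda>: "integral_submodule \<Lambda>" by (rule is_lattice_submodule[OF assms])
  have N: "integral_submodule ?N"
    using \<Lambda> by (auto simp: integral_submodule_def form_add form_scale integers_add integers_mult)
  have B\<Lambda>: "B \<subseteq> \<Lambda>" using B integral_span_superset by auto
  show ?thesis
  proof (cases "\<forall>b\<in>B. h b y \<in> integer_ring v")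
    case True
    then have "\<Lambda> \<subseteq> ?N"
      unfolding B(2) using B\<Lambda> N by (intro integral_span_minimal) (auto simp: B(2))
    then have "?N = \<Lambda>" by blast
    with assms show ?thesis by simp
  next
    case False
    \<comment> \<open>The generator \<open>b0\<close> with the most negative pairing valuation
      serves as pivot. The submodule is generated by a suitable multiple \<open>g\<close> of
      \<open>b0\<close> and by the vectors \<open>\<pi> b\<close>, corrected by integral multiples
      of \<open>b0\<close> so as to be orthogonal to \<open>y\<close>. Zero pairings are left out,
      as \<open>v 0\<close> is meaningless.\<close>
    define V where "V = {b\<in>B. h b y \<noteq> 0}"
    from False obtain b1 where b1: "b1 \<in> B" "h b1 y \<notin> integer_ring v" by blast
    then have b1V: "b1 \<in> V" "v (h b1 y) < 0" by (auto simp: V_def integers_iff)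
    have "finite ((\<lambda>b. v (h b y)) ` V)" "(\<lambda>b. v (h b y)) ` V \<noteq> {}"
      using b1V B(1) by (auto simp: V_def)
    from Min_in[OF this] Min_le[OF this(1)]
    obtain b0 where b0: "b0 \<in> V" "\<And>b. b \<in> V \<Longrightarrow> v (h b0 y) \<le> v (h b y)"
      by (smt (verit) imageE imageI)
    have neg: "v (h b0 y) < 0" using b0(2)[OF b1V(1)] b1V(2) by simp
    have b0': "b0 \<in> B" "h b0 y \<noteq> 0" using b0 by (auto simp: V_def)
    \<comment> \<open>This exponent makes \<open>h g y\<close> a unit, so \<open>g\<close> is in
      \<open>?N\<close> and its coefficient \<open>h z y / h g y\<close> is integral for every
      \<open>z\<close> in \<open>?N\<close>.\<close>
    define k where "k = - v (h b0 y)"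
    define g where "g = scale (of_nat p powi k) b0"
    define \<pi> where "\<pi> z = z - scale (h z y / h b0 y) b0" for z
    define B' where "B' = insert g (\<pi> ` B)"
    have fB': "finite B'" using B(1) by (simp add: B'_def)
    have q: "h b y / h b0 y \<in> integer_ring v" if "b \<in> B" for b
      using b0(2)[of b] b0' that by (intro integers_divide) (auto simp: V_def)
    have pk: "of_nat p powi k \<in> integer_ring v"
      using neg by (intro integersI) (simp add: v_power_int k_def)
    have hg: "h g y \<noteq> 0" "v (h g y) = 0"
      using b0' by (auto simp: g_def form_scale val_mult v_power_int k_def)
    have neg\<Lambda>: "z - scale a b \<in> \<Lambda>" if "z \<in> \<Lambda>" "b \<in> \<Lambda>" "a \<in> integer_ring v" for z a b
    proof -
      have "z + scale (- a) b \<in> \<Lambda>"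
        using that \<Lambda> integers_uminus unfolding integral_submodule_def by blast
      then show ?thesis by simp
    qed
    have B'N: "B' \<subseteq> ?N"
    proof -
      have "g \<in> ?N"
        using \<Lambda> pk B\<Lambda> b0' hg by (auto simp: g_def integral_submodule_def integersI)
      moreover have "\<pi> b \<in> ?N" if "b \<in> B" for b
        using neg\<Lambda>[OF _ _ q[OF that]] that B\<Lambda> b0'
        by (auto simp: \<pi>_def form_diff_left form_scale)
      ultimately show ?thesis by (auto simp: B'_def)
    qed
    have sub: "integral_span v scale B' \<subseteq> ?N"
      by (rule integral_span_minimal[OF N B'N])
    define S where "S = integral_span v scale B'"
    have S: "integral_submodule S" by (simp add: S_def integral_submodule_span)
    have B'S: "B' \<subseteq> S" using integral_span_superset[OF fB'] by (auto simp: S_def)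
    have \<pi>_add: "\<pi> (z + w) = \<pi> z + \<pi> w" and \<pi>_scale: "\<pi> (scale a z) = scale a (\<pi> z)" for a z w
      by (simp_all add: \<pi>_def form_add form_scale add_divide_distrib scale_left_distrib
          scale_right_diff_distrib)
    have "\<pi> 0 = 0" by (simp add: \<pi>_def)
    then have "integral_submodule {z. \<pi> z \<in> S}"
      using S by (auto simp: integral_submodule_def \<pi>_add \<pi>_scale)
    then have \<pi>S: "\<Lambda> \<subseteq> {z. \<pi> z \<in> S}"
      unfolding B(2) using B'S by (intro integral_span_minimal) (auto simp: B'_def)
    have "?N \<subseteq> S"
    proof
      fix z assume z: "z \<in> ?N"
      have "h z y / h g y \<in> integer_ring v"
        using z hg by (intro integers_divide) (auto simp: integers_iff)
      then have "\<pi> z + scale (h z y / h g y) g \<in> S"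
        using \<pi>S z S B'S by (auto simp: integral_submodule_def B'_def)
      moreover have "scale (h z y / h g y) g = scale (h z y / h b0 y) b0"
        by (simp add: g_def form_scale)
      ultimately show "z \<in> S" by (simp add: \<pi>_def)
    qed
    with sub have "?N = integral_span v scale B'" by (auto simp: S_def)
    moreover have "span B' = W"
    proof
      have "B' \<subseteq> W" using B'N is_lattice_subset[OF assms] by blast
      then show "span B' \<subseteq> W"
        by (intro span_minimal is_lattice_subspace[OF assms])
      \<comment> \<open>Over the field the power of \<open>p\<close> can be undone:
        \<open>b0\<close> is recovered from \<open>g\<close>, and then each \<open>b\<close> from
        \<open>\<pi> b\<close>.\<close>
      have "scale (of_nat p powi (- k)) g \<in> span B'"
        by (intro span_scale span_base) (simp add: B'_def)
      then have b0s: "b0 \<in> span B'" by (simp add: g_def power_int_minus)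
      have "b \<in> span B'" if "b \<in> B" for b
      proof -
        have "\<pi> b + scale (h b y / h b0 y) b0 \<in> span B'"
          using that by (intro span_add span_scale b0s) (auto simp: B'_def intro: span_base)
        then show ?thesis by (simp add: \<pi>_def)
      qed
      then show "W \<subseteq> span B'"
        using span_minimal[of B "span B'"] B(3) by auto
    qed
    ultimately show ?thesis using is_latticeI[OF fB'] by simp
  qed
qed

text \<open>As \<open>y\<close> is in \<open>\<Lambda>\<close>, the smaller lattice still contains
  the dual of \<open>\<Lambda>\<close>; by biduality its own dual stays inside
  \<open>\<Lambda>\<close>. As \<open>h y y\<close> is integral, \<open>y\<close> itself survives
  the restriction, so every element of the new dual satisfies the defining condition.\<close>

lemma vertices_restrict:
  assumes W: "nondegenerate_subspace W" and \<Lambda>: "\<Lambda> \<in> vertices W"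
    and y: "y \<in> \<Lambda>" "h y y \<in> integer_ring v"
  shows "{z\<in>\<Lambda>. h z y \<in> integer_ring v} \<in> vertices W" (is "?N \<in> _")
proof (rule verticesI)
  show "is_lattice v scale W ?N"
    by (rule is_lattice_restrict[OF vertices_lattice[OF \<Lambda>]])
  have sub: "?N \<subseteq> \<Lambda>" by blast
  show "scale (of_nat p) z \<in> dual v h W ?N" if "z \<in> ?N" for z
    using vertices_p_dual[OF \<Lambda>, of z] dual_antimono[OF sub] that by blast
  show "dual v h W ?N \<subseteq> ?N"
  proof
    fix z assume z: "z \<in> dual v h W ?N"
    have "dual v h W \<Lambda> \<subseteq> ?N"
      using vertices_dual[OF \<Lambda>] y(1) by (auto simp: dual_def)
    then have "z \<in> dual v h W (dual v h W \<Lambda>)"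
      using dual_antimono z by blast
    then have "z \<in> \<Lambda>"
      using dual_dual_subset[OF W vertices_lattice[OF \<Lambda>]] by blast
    moreover have "h z y \<in> integer_ring v"
      using z y by (auto intro: dual_form)
    ultimately show "z \<in> ?N" by simp
  qed
qed

text \<open>The conditions are imposed one at a time. Integrality of the mutual pairings, through
  the final clause, ensures that the next vector still lies in the lattice already shrunk.\<close>

lemma vertices_shrink:
  assumes W: "nondegenerate_subspace W" and "finite Y" "\<Lambda> \<in> vertices W" "Y \<subseteq> \<Lambda>"
    and "\<And>w w'. w \<in> Y \<Longrightarrow> w' \<in> Y \<Longrightarrow> h w w' \<in> integer_ring v"
  shows "\<exists>\<Lambda>'\<in>vertices W. \<Lambda>' \<subseteq> \<Lambda> \<and> Y \<subseteq> dual v h W \<Lambda>' \<and>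
    (\<forall>u\<in>\<Lambda>. (\<forall>w\<in>Y. h u w \<in> integer_ring v) \<longrightarrow> u \<in> \<Lambda>')"
  using assms(2-)
proof (induction Y rule: finite_induct)
  case (insert w Y)
  then obtain \<Lambda>1 where \<Lambda>1: "\<Lambda>1 \<in> vertices W" "\<Lambda>1 \<subseteq> \<Lambda>" "Y \<subseteq> dual v h W \<Lambda>1"
    and u1: "\<And>u. u \<in> \<Lambda> \<Longrightarrow> \<forall>w\<in>Y. h u w \<in> integer_ring v \<Longrightarrow> u \<in> \<Lambda>1"
    by auto
  define \<Lambda>2 where "\<Lambda>2 = {z\<in>\<Lambda>1. h z w \<in> integer_ring v}"
  have w: "w \<in> \<Lambda>1"
    using insert.prems by (intro u1) auto
  have wW: "w \<in> W"
    using w is_lattice_subset[OF vertices_lattice[OF \<Lambda>1(1)]] by blast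
  have "\<Lambda>2 \<in> vertices W"
    unfolding \<Lambda>2_def using insert.prems by (intro vertices_restrict W \<Lambda>1 w) auto
  moreover have "\<Lambda>2 \<subseteq> \<Lambda>1" by (auto simp: \<Lambda>2_def)
  moreover have "w \<in> dual v h W \<Lambda>2"
    using wW by (intro dualI) (auto simp: \<Lambda>2_def form_integers_sym[of w])
  moreover have "Y \<subseteq> dual v h W \<Lambda>2"
    using \<Lambda>1(3) dual_antimono[OF \<open>\<Lambda>2 \<subseteq> \<Lambda>1\<close>] by blast
  moreover have "u \<in> \<Lambda>2" if "u \<in> \<Lambda>" "\<forall>w\<in>insert w Y. h u w \<in> integer_ring v" for u
    using that u1 by (simp add: \<Lambda>2_def)
  ultimately show ?case
    using \<Lambda>1(2) by (intro bexI[of _ \<Lambda>2]) auto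
qed auto

section \<open>Splitting off orthogonal summands by projection\<close>

lemma is_lattice_image:
  assumes "is_lattice v scale W \<Lambda>" and f: "module_hom scale scale f"
  shows "is_lattice v scale (f ` W) (f ` \<Lambda>)"
proof -
  interpret f: module_hom scale scale f by (rule f)
  obtain B where B: "finite B" "\<Lambda> = integral_span v scale B" "span B = W"
    using assms(1) by (rule is_latticeE)
  have fB: "finite (f ` B)" using B by simp
  have "integral_submodule {z. f z \<in> integral_span v scale (f ` B)}"
    using integral_submodule_span[of "f ` B"]
    by (auto simp: integral_submodule_def f.add f.scale f.zero)
  then have "\<Lambda> \<subseteq> {z. f z \<in> integral_span v scale (f ` B)}"
    unfolding B(2) using integral_span_superset[OF fB] by (intro integral_span_minimal) auto
  moreover have "integral_submodule (f ` \<Lambda>)"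
    using is_lattice_submodule[OF assms(1)]
    by (auto simp: integral_submodule_def f.add[symmetric] f.scale[symmetric] image_iff)
       (use f.zero in metis)
  then have "integral_span v scale (f ` B) \<subseteq> f ` \<Lambda>"
    using integral_span_superset[OF B(1)] by (intro integral_span_minimal) (auto simp: B(2))
  ultimately have "f ` \<Lambda> = integral_span v scale (f ` B)" by blast
  moreover have "span (f ` B) = f ` W"
    using f.span_image[of B] B(3) by simp
  ultimately show ?thesis using is_latticeI[OF fB] by simp
qed

text \<open>By \<open>coeff\<close>, the orthogonal projection \<open>\<pi>\<close> along the
  \<open>e i\<close> maps \<open>\<Lambda>\<close> to itself, so
  \<open>\<Lambda> \<inter> W'\<close> is its image and hence a lattice. A vector of
  \<open>W'\<close> pairs with \<open>\<Lambda>\<close> only through this summand, so the duality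
  conditions on the summand are inherited from \<open>\<Lambda>\<close>.\<close>

lemma vertices_split:
  fixes e :: "'i \<Rightarrow> 'c"
  assumes \<Lambda>: "\<Lambda> \<in> vertices W" and J: "finite J"
    and e: "\<And>i. i \<in> J \<Longrightarrow> e i \<in> \<Lambda>" "\<And>i. i \<in> J \<Longrightarrow> h (e i) (e i) \<noteq> 0"
      "\<And>i j. i \<in> J \<Longrightarrow> j \<in> J \<Longrightarrow> i \<noteq> j \<Longrightarrow> h (e i) (e j) = 0"
    and coeff: "\<And>z i. z \<in> \<Lambda> \<Longrightarrow> i \<in> J \<Longrightarrow> h z (e i) / h (e i) (e i) \<in> integer_ring v"
    and W': "W' = {z\<in>W. \<forall>i\<in>J. h z (e i) = 0}"
  shows "\<Lambda> \<inter> W' \<in> vertices W'"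
    and "z \<in> \<Lambda> \<Longrightarrow> \<exists>c. \<exists>y\<in>\<Lambda> \<inter> W'. (\<forall>i. c i \<in> integer_ring v) \<and> z = (\<Sum>i\<in>J. scale (c i) (e i)) + y"
proof -
  define q where "q z i = h z (e i) / h (e i) (e i)" for z i
  define \<pi> where "\<pi> z = z - (\<Sum>i\<in>J. scale (q z i) (e i))" for z
  have lat: "is_lattice v scale W \<Lambda>" by (rule vertices_lattice[OF \<Lambda>])
  have sub: "subspace W" by (rule is_lattice_subspace[OF lat])
  have \<Lambda>W: "\<Lambda> \<subseteq> W" by (rule is_lattice_subset[OF lat])
  have \<Lambda>mod: "integral_submodule \<Lambda>" by (rule is_lattice_submodule[OF lat])
  have \<pi>_orth: "h (\<pi> z) (e j) = 0" if "j \<in> J" for z j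
  proof -
    have "(\<Sum>i\<in>J. q z i * h (e i) (e j)) = (\<Sum>i\<in>J. if i = j then h z (e j) else 0)"
      using that e by (intro sum.cong) (auto simp: q_def)
    then show ?thesis
      using that J by (simp add: \<pi>_def form_diff_left form_sum_left form_scale)
  qed
  have \<pi>W: "\<pi> z \<in> W" if "z \<in> W" for z
    unfolding \<pi>_def using that e(1) \<Lambda>W
    by (intro subspace_diff[OF sub] subspace_sum[OF sub] subspace_scale[OF sub]) auto
  have \<pi>\<Lambda>: "\<pi> z \<in> \<Lambda>" if "z \<in> \<Lambda>" for z
  proof -
    have "(\<Sum>i\<in>J. scale (- q z i) (e i)) \<in> \<Lambda>"
      using coeff[OF that] e(1) \<Lambda>mod integers_uminus
      by (intro integral_submodule_sum) (auto simp: integral_submodule_def q_def simp del: scale_minus_left)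
    then have "z + (\<Sum>i\<in>J. scale (- q z i) (e i)) \<in> \<Lambda>"
      using that \<Lambda>mod unfolding integral_submodule_def by blast
    then show ?thesis by (simp add: \<pi>_def sum_negf)
  qed
  have \<pi>_id: "\<pi> z = z" if "z \<in> W'" for z
    using that by (simp add: \<pi>_def q_def W')
  have hom: "module_hom scale scale \<pi>"
    by unfold_locales (auto simp: \<pi>_def q_def form_add form_scale add_divide_distrib
        scale_left_distrib scale_right_diff_distrib sum.distrib scale_sum_right)
  have "\<pi> ` W = W'"
    using \<pi>W \<pi>_orth \<pi>_id by (force simp: W')
  moreover have "\<pi> ` \<Lambda> = \<Lambda> \<inter> W'"
  proof
    show "\<pi> ` \<Lambda> \<subseteq> \<Lambda> \<inter> W'"
      using \<pi>\<Lambda> \<pi>W \<pi>_orth \<Lambda>W by (auto simp: W')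
    show "\<Lambda> \<inter> W' \<subseteq> \<pi> ` \<Lambda>"
      using \<pi>_id by (metis IntD1 IntD2 imageI subsetI)
  qed
  ultimately have lat': "is_lattice v scale W' (\<Lambda> \<inter> W')"
    using is_lattice_image[OF lat hom] by simp
  show split: "\<exists>c. \<exists>y\<in>\<Lambda> \<inter> W'. (\<forall>i. c i \<in> integer_ring v) \<and> z = (\<Sum>i\<in>J. scale (c i) (e i)) + y"
    if "z \<in> \<Lambda>" for z
  proof (intro exI bexI conjI allI)
    show "\<pi> z \<in> \<Lambda> \<inter> W'"
      using that \<pi>\<Lambda> \<pi>W \<pi>_orth \<Lambda>W by (auto simp: W')
    \<comment> \<open>Coefficients outside \<open>J\<close> are set to 0 because integrality is
      demanded at every index, as in \<open>Phi\<close>.\<close>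
    show "(if i \<in> J then q z i else 0) \<in> integer_ring v" for i
      using coeff[OF that] by (simp add: q_def)
    show "z = (\<Sum>i\<in>J. scale (if i \<in> J then q z i else 0) (e i)) + \<pi> z"
      by (simp add: \<pi>_def cong: sum.cong)
  qed
  show "\<Lambda> \<inter> W' \<in> vertices W'"
  proof (rule verticesI[OF lat'])
    fix z assume z: "z \<in> \<Lambda> \<inter> W'"
    then have "scale (of_nat p) z \<in> dual v h W \<Lambda>"
      using vertices_p_dual[OF \<Lambda>] by blast
    moreover have "scale (of_nat p) z \<in> W'"
      using z sub by (auto simp: W' form_scale subspace_scale)
    ultimately show "scale (of_nat p) z \<in> dual v h W' (\<Lambda> \<inter> W')"
      by (auto simp: dual_def)
  next
    show "dual v h W' (\<Lambda> \<inter> W') \<subseteq> \<Lambda> \<inter> W'"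
    proof
      fix u assume u: "u \<in> dual v h W' (\<Lambda> \<inter> W')"
      then have uW: "u \<in> W" "u \<in> W'" by (auto simp: dual_def W')
      have "h z u \<in> integer_ring v" if z: "z \<in> \<Lambda>" for z
      proof -
        obtain c y where cy: "y \<in> \<Lambda> \<inter> W'" "z = (\<Sum>i\<in>J. scale (c i) (e i)) + y"
          using split[OF z] by blast
        have "h (e i) u = 0" if "i \<in> J" for i
          using uW that form_eq_0_sym by (auto simp: W')
        then have "h z u = h y u"
          by (simp add: cy form_add form_sum_left form_scale)
        then show ?thesis
          using dual_form[OF u cy(1)] form_integers_sym by simp
      qed
      then have "u \<in> dual v h W \<Lambda>"
        using uW by (intro dualI) (auto simp: form_integers_sym[of u])
      then show "u \<in> \<Lambda> \<inter> W'"
        using vertices_dual[OF \<Lambda>] uW by blast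
    qed
  qed
qed

end

section \<open>The algorithm\<close>

text \<open>Since \<open>v\<close> has no infinite value, finiteness of the valuations of the norms
  is expressed by \<open>norm_nonzero\<close>. It also makes orthogonal projection along the
  \<open>x i\<close> possible.\<close>

locale orthogonal_family = hermitian_space p v \<sigma> scale h
  for p :: nat
    and v :: "'k::field_char_0 \<Rightarrow> int"
    and \<sigma> :: "'k \<Rightarrow> 'k"
    and scale :: "'k \<Rightarrow> 'c::ab_group_add \<Rightarrow> 'c"
    and h :: "'c \<Rightarrow> 'c \<Rightarrow> 'k" +
  fixes m :: nat and x :: "nat \<Rightarrow> 'c"
  assumes orthogonal: "i \<in> {1..m} \<Longrightarrow> j \<in> {1..m} \<Longrightarrow> i \<noteq> j \<Longrightarrow> h (x i) (x j) = 0"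
    and norm_nonzero: "i \<in> {1..m} \<Longrightarrow> h (x i) (x i) \<noteq> 0"
    and norm_nonneg: "i \<in> {1..m} \<Longrightarrow> 0 \<le> norm_val v h (x i)"
    and norm_mono: "1 \<le> i \<Longrightarrow> i \<le> j \<Longrightarrow> j \<le> m \<Longrightarrow> norm_val v h (x i) \<le> norm_val v h (x j)"
begin

section \<open>Index bounds and the orthogonal complements\<close>

abbreviation idx :: "nat \<Rightarrow> nat" where
  "idx r \<equiv> m_idx v h m x r"

abbreviation C :: "nat \<Rightarrow> 'c set" where
  "C r \<equiv> C_sub v scale h m x r"

lemma idx_le: "idx r \<le> m"
  unfolding m_idx_def by (subst Max_le_iff) auto

text \<open>By monotonicity, the indices with norm valuation below \<open>r\<close> form an initial
  segment. An index \<open>i \<ge> 1\<close> below the maximum rules out the default value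
  0.\<close>

lemma le_idx_iff:
  assumes "i \<in> {1..m}"
  shows "i \<le> idx r \<longleftrightarrow> norm_val v h (x i) < int r"
proof
  let ?A = "insert 0 {i\<in>{1..m}. norm_val v h (x i) < int r}"
  show "i \<le> idx r" if "norm_val v h (x i) < int r"
    unfolding m_idx_def using assms that by (intro Max_ge) auto
  assume i: "i \<le> idx r"
  have "idx r \<in> ?A"
    unfolding m_idx_def by (rule Max_in) auto
  then have "norm_val v h (x (idx r)) < int r" "idx r \<le> m"
    using i assms by auto
  with norm_mono[of i "idx r"] i assms show "norm_val v h (x i) < int r" by auto
qed

lemma idx_mono:
  assumes "r \<le> r'"
  shows "idx r \<le> idx r'"
proof (cases "idx r = 0")
  case False
  then show ?thesis
    using le_idx_iff[of "idx r" r] le_idx_iff[of "idx r" r'] idx_le[of r] assms by auto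
qed simp

lemma C_sub_eq: "C r = {z. \<forall>i\<in>{1..idx r}. h z (x i) = 0}"
proof -
  have "h z u = 0" if "\<forall>i\<in>{1..idx r}. h z (x i) = 0" "u \<in> span (x ` {1..idx r})" for z u
  proof -
    have "subspace {u. h z u = 0}"
      by (auto simp: subspace_def form_add_right form_scale_right)
    moreover have "x ` {1..idx r} \<subseteq> {u. h z u = 0}" using that by auto
    ultimately show ?thesis using span_minimal that(2) by blast
  qed
  then show ?thesis
    unfolding C_sub_def orth_compl_def by (auto simp: span_base)
qed

text \<open>Any \<open>y\<close> splits into its projection \<open>u\<close> to the span of the
  removed vectors and a part in \<open>C r\<close>. A radical vector of \<open>C r\<close> is
  orthogonal to both, hence to the whole space.\<close>

lemma nondegenerate_C: "nondegenerate_subspace (C r)"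
  unfolding nondegenerate_subspace_def
proof (intro conjI ballI impI)
  show "subspace (C r)"
    by (auto simp: C_sub_eq subspace_def form_add form_scale)
  fix z assume z: "z \<in> C r" "\<forall>w\<in>C r. h z w = 0"
  show "z = 0"
  proof (rule nondegenerate)
    fix y
    define u where "u = (\<Sum>i\<in>{1..idx r}. scale (h y (x i) / h (x i) (x i)) (x i))"
    have "h u (x j) = h y (x j)" if j: "j \<in> {1..idx r}" for j
    proof -
      have "h u (x j) = (\<Sum>i\<in>{1..idx r}. if i = j then h y (x j) else 0)"
        unfolding u_def form_sum_left form_scale
        using j idx_le[of r] norm_nonzero[of j] orthogonal[of _ j] by (intro sum.cong) auto
      then show ?thesis using j by simp
    qed
    then have "y - u \<in> C r" by (simp add: C_sub_eq form_diff_left)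
    with z have "h z (y - u) = 0" by blast
    moreover have "h (x i) z = 0" if "i \<in> {1..idx r}" for i
      using z(1) that form_eq_0_sym by (auto simp: C_sub_eq)
    then have "h u z = 0"
      by (simp add: u_def form_sum_left form_scale)
    then have "h z u = 0" using form_eq_0_sym by blast
    ultimately show "h z y = 0"
      using form_add_right[of z "y - u" u] by simp
  qed
qed

lemma scale_x_in_C:
  assumes "i \<in> {idx r + 1..m}"
  shows "scale a (x i) \<in> C r"
  using assms orthogonal by (auto simp: C_sub_eq form_scale)

text \<open>With \<open>k = s\<close> these are \<open>S\<^sub>s\<close> for \<open>r = 2s\<close> and \<open>S'\<^sub>s\<^sub>+\<^sub>1\<close> for \<open>r = 2s + 2\<close>.\<close>

definition rescaled_cycle :: "nat \<Rightarrow> int \<Rightarrow> 'c set set" where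
  "rescaled_cycle r k = {\<Lambda> \<in> L_sub p v scale h m x r.
     \<forall>i\<in>{idx r + 1..m}. scale (of_nat p powi (- k)) (x i) \<in> dual v h (C r) \<Lambda>}"

lemma form_scaled:
  "h (scale (of_nat p powi a) (x i)) (scale (of_nat p powi b) (x j)) =
     of_nat p powi (a + b) * h (x i) (x j)"
  by (simp add: form_scale form_scale_right power_int_add)

lemma v_form_scaled:
  assumes "i \<in> {1..m}"
  shows "v (of_nat p powi a * h (x i) (x i)) = a + norm_val v h (x i)"
  using norm_nonzero[OF assms] by (simp add: val_mult v_power_int norm_val_def)

section \<open>The two steps of the algorithm on rescaled cycles\<close>

lemma step1_rescaled_cycle:
  "step1 p v scale h m x s (rescaled_cycle (2*s + 2) (int s)) = rescaled_cycle (2*s) (int s)"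
proof -
  define J where "J = {idx (2*s) + 1..idx (2*s + 2)}"
  define a where "a i = a_exp v h (x i)" for i
  define e where "e i = scale (of_nat p powi (- a i)) (x i)" for i
  define y where "y i = scale (of_nat p powi (- int s)) (x i)" for i
  have mono: "idx (2*s) \<le> idx (2*s + 2)" by (rule idx_mono) simp
  have Jm: "i \<in> {1..m}" if "i \<in> J" for i
    using that idx_le[of "2*s + 2"] by (auto simp: J_def)
  have norm_J: "2 * int s \<le> norm_val v h (x i)" "norm_val v h (x i) < 2 * int s + 2"
    if "i \<in> J" for i
    using that Jm[OF that] le_idx_iff[OF Jm[OF that], of "2*s"] le_idx_iff[OF Jm[OF that], of "2*s+2"]
    by (auto simp: J_def)
  \<comment> \<open>The norm valuation is \<open>2s\<close> or \<open>2s + 1\<close> on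
    \<open>J\<close>, and \<open>a i\<close> is \<open>s\<close> or \<open>s + 1\<close>
    accordingly. Hence \<open>e i\<close> has norm of valuation 0 or -1.\<close>
  have a_J: "a i = norm_val v h (x i) - int s" if "i \<in> J" for i
    using norm_J[OF that] unfolding a_def a_exp_def by (auto elim!: evenE oddE)
  have W': "C (2*s + 2) = {z \<in> C (2*s). \<forall>i\<in>J. h z (e i) = 0}"
  proof -
    have "{1..idx (2*s + 2)} = {1..idx (2*s)} \<union> J" using mono by (auto simp: J_def)
    then show ?thesis by (auto simp: C_sub_eq e_def form_scale_right)
  qed
  have Phi_eq: "Phi p v scale h m x s M =
    {(\<Sum>i\<in>J. scale (c i) (e i)) + u | c u. (\<forall>i. c i \<in> integer_ring v) \<and> u \<in> M}" for M
    by (simp add: Phi_def J_def e_def a_def)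
  have e_orth: "h (e i) (e j) = 0" if "i \<in> J" "j \<in> J" "i \<noteq> j" for i j
    using that Jm by (simp add: e_def form_scaled orthogonal)
  have e_norm: "h (e i) (e i) \<noteq> 0" "v (h (e i) (e i)) = 2 * int s - norm_val v h (x i)"
    if "i \<in> J" for i
    using Jm[OF that] norm_nonzero[OF Jm[OF that]] a_J[OF that]
    by (auto simp: e_def form_scaled v_form_scaled)
  \<comment> \<open>For \<open>i = j\<close> the valuation is
    \<open>- s - a i + norm_val v h (x i) = 0\<close>, so this pairing is a unit; all others
    vanish.\<close>
  have ye: "h (y j) (e i) \<in> integer_ring v" if "i \<in> J" "j \<in> {1..m}" for i j
  proof (cases "i = j")
    case True
    then show ?thesis
      using that a_J[OF that(1)] by (intro integersI) (simp add: y_def e_def form_scaled v_form_scaled)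
  qed (use that Jm[of i] in \<open>simp add: y_def e_def form_scaled orthogonal\<close>)
  show ?thesis
  proof (intro equalityI subsetI)
    fix \<Lambda> assume "\<Lambda> \<in> step1 p v scale h m x s (rescaled_cycle (2*s + 2) (int s))"
    then obtain M where \<Lambda>: "\<Lambda> \<in> L_sub p v scale h m x (2*s)"
      and M: "M \<in> rescaled_cycle (2*s + 2) (int s)" "\<Lambda> \<subseteq> Phi p v scale h m x s M"
      by (auto simp: step1_def)
    have MC: "M \<subseteq> C (2*s + 2)"
      using M(1) is_lattice_subset vertices_lattice unfolding rescaled_cycle_def L_sub_def by blast
    have "y i \<in> dual v h (C (2*s)) \<Lambda>" if i: "i \<in> {idx (2*s) + 1..m}" for i
    proof (rule dualI)
      show "y i \<in> C (2*s)" unfolding y_def by (rule scale_x_in_C[OF i])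
      fix z assume "z \<in> \<Lambda>"
      then obtain c u where z: "z = (\<Sum>j\<in>J. scale (c j) (e j)) + u" "u \<in> M"
        and c: "\<And>j. c j \<in> integer_ring v"
        using M(2) unfolding Phi_eq by blast
      have "h (e j) (y i) \<in> integer_ring v" if "j \<in> J" for j
        using ye[OF that] i form_integers_sym by auto
      then have "(\<Sum>j\<in>J. c j * h (e j) (y i)) \<in> integer_ring v"
        using c by (induction J rule: infinite_finite_induct) (auto intro!: integers_add integers_mult)
      \<comment> \<open>For an index in \<open>J\<close>, \<open>y i\<close> is a multiple of a
        vector orthogonal to \<open>C (2*s + 2)\<close>, which contains \<open>M\<close>. For larger
        indices the assumption on \<open>M\<close> applies.\<close>
      moreover have "h u (y i) \<in> integer_ring v"
      proof (cases "i \<le> idx (2*s + 2)")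
        case True
        then show ?thesis
          using z(2) MC i by (auto simp: C_sub_eq y_def form_scale_right)
      next
        case False
        then have "y i \<in> dual v h (C (2*s + 2)) M"
          using M(1) i by (auto simp: rescaled_cycle_def y_def)
        then show ?thesis
          using z(2) form_integers_sym dual_form by blast
      qed
      ultimately have "h z (y i) \<in> integer_ring v"
        by (simp add: z form_add form_sum_left form_scale integers_add)
      then show "h (y i) z \<in> integer_ring v" using form_integers_sym by blast
    qed
    with \<Lambda> show "\<Lambda> \<in> rescaled_cycle (2*s) (int s)"
      by (simp add: rescaled_cycle_def y_def)
  next
    fix \<Lambda> assume "\<Lambda> \<in> rescaled_cycle (2*s) (int s)"
    then have \<Lambda>: "\<Lambda> \<in> vertices (C (2*s))"
      and y\<Lambda>: "\<And>i. i \<in> {idx (2*s) + 1..m} \<Longrightarrow> y i \<in> dual v h (C (2*s)) \<Lambda>"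
      by (auto simp: rescaled_cycle_def L_sub_def y_def)
    have J_range: "i \<in> {idx (2*s) + 1..m}" if "i \<in> J" for i
      using that idx_le[of "2*s + 2"] by (auto simp: J_def)
    have sub: "subspace (C (2*s))"
      by (rule is_lattice_subspace[OF vertices_lattice[OF \<Lambda>]])
    have pe: "scale (of_nat p) (e i) \<in> dual v h (C (2*s)) \<Lambda>" if i: "i \<in> J" for i
    proof -
      \<comment> \<open>The exponent \<open>1 - a i + s\<close> is 1 or 0, so \<open>p\<close> times
        \<open>e i\<close> is an integral multiple of \<open>y i\<close>.\<close>
      have "scale (of_nat p) (e i) = scale (of_nat p powi (1 - a i + int s)) (y i)"
        by (simp add: e_def y_def power_int_add[symmetric] power_int_add_1'[symmetric])
      moreover have "of_nat p powi (1 - a i + int s) \<in> integer_ring v"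
        using a_J[OF i] norm_J[OF i] by (intro integersI) (simp add: v_power_int)
      ultimately show ?thesis
        using y\<Lambda>[OF J_range[OF i]] integral_submodule_dual[OF sub, of \<Lambda>]
        by (auto simp: integral_submodule_def)
    qed
    have pee: "of_nat p * h (e i) (e j) \<in> integer_ring v" if "i \<in> J" "j \<in> J" for i j
    proof (cases "i = j")
      case True
      then show ?thesis
        using e_norm[OF that(1)] norm_J[OF that(1)] by (intro integersI) (simp add: val_mult)
    qed (use that e_orth in simp)
    have fJ: "finite J" by (simp add: J_def)
    have eC: "e ` J \<subseteq> C (2*s)"
      using scale_x_in_C J_range by (auto simp: e_def)
    have pe': "scale (of_nat p) w \<in> dual v h (C (2*s)) \<Lambda>" if "w \<in> e ` J" for w
      using that pe by blast
    have pee': "of_nat p * h w w' \<in> integer_ring v" if "w \<in> e ` J" "w' \<in> e ` J" for w w'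
      using that pee by blast
    obtain \<Lambda>' where \<Lambda>': "\<Lambda>' \<in> vertices (C (2*s))" "\<Lambda> \<subseteq> \<Lambda>'" "e ` J \<subseteq> \<Lambda>'"
      and du: "\<forall>u\<in>dual v h (C (2*s)) \<Lambda>. (\<forall>w\<in>e ` J. h u w \<in> integer_ring v)
        \<longrightarrow> u \<in> dual v h (C (2*s)) \<Lambda>'"
      using vertices_enlarge[OF finite_imageI[OF fJ] \<Lambda> eC pe' pee'] by blast
    \<comment> \<open>By \<open>ye\<close> the \<open>y i\<close> pair integrally with all adjoined
      vectors, so they survive in the smaller dual.\<close>
    have y\<Lambda>': "y i \<in> dual v h (C (2*s)) \<Lambda>'" if "i \<in> {idx (2*s) + 1..m}" for i
      using that ye y\<Lambda> du by auto
    \<comment> \<open>The factor relating this quotient to \<open>h z (y i)\<close> has valuation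
      \<open>(s - a i) - (2s - norm_val v h (x i)) = 0\<close>, so it is a unit.\<close>
    have coeff: "h z (e i) / h (e i) (e i) \<in> integer_ring v" if z: "z \<in> \<Lambda>'" and i: "i \<in> J" for z i
    proof -
      have "h (y i) z \<in> integer_ring v"
        using dual_form[OF y\<Lambda>'[OF J_range[OF i]] z] .
      then have hz: "h z (y i) \<in> integer_ring v" using form_integers_sym by blast
      have "h z (e i) = of_nat p powi (int s - a i) * h z (y i)"
        by (simp add: e_def y_def form_scale_right power_int_add[symmetric] mult.assoc[symmetric])
      moreover have "of_nat p powi (int s - a i) / h (e i) (e i) \<in> integer_ring v"
        using e_norm[OF i] a_J[OF i] by (intro integersI) (simp add: v_divide v_power_int)
      ultimately show ?thesis
        using integers_mult[OF _ hz] by (metis times_divide_eq_left)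
    qed
    define M where "M = \<Lambda>' \<inter> C (2*s + 2)"
    have eJ: "e i \<in> \<Lambda>'" if "i \<in> J" for i using \<Lambda>'(3) that by blast
    have M: "M \<in> vertices (C (2*s + 2))"
      unfolding M_def
      by (rule vertices_split(1)[OF \<Lambda>'(1) fJ _ _ _ _ W']) (simp_all add: eJ e_norm(1) e_orth coeff)
    have split: "\<exists>c. \<exists>u\<in>M. (\<forall>i. c i \<in> integer_ring v) \<and> z = (\<Sum>i\<in>J. scale (c i) (e i)) + u"
      if "z \<in> \<Lambda>'" for z
      unfolding M_def
      by (rule vertices_split(2)[OF \<Lambda>'(1) fJ _ _ _ _ W' that])
        (simp_all add: eJ e_norm(1) e_orth coeff)
    have "y i \<in> dual v h (C (2*s + 2)) M" if i: "i \<in> {idx (2*s + 2) + 1..m}" for i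
    proof (rule dualI)
      show "y i \<in> C (2*s + 2)" unfolding y_def by (rule scale_x_in_C[OF i])
      show "h (y i) z \<in> integer_ring v" if "z \<in> M" for z
        using that i mono by (intro dual_form[OF y\<Lambda>']) (auto simp: M_def)
    qed
    then have "M \<in> rescaled_cycle (2*s + 2) (int s)"
      using M by (simp add: rescaled_cycle_def L_sub_def y_def)
    moreover have "\<Lambda> \<subseteq> Phi p v scale h m x s M"
    proof
      fix z assume "z \<in> \<Lambda>"
      then have "z \<in> \<Lambda>'" using \<Lambda>'(2) by blast
      then show "z \<in> Phi p v scale h m x s M"
        unfolding Phi_eq using split by blast
    qed
    ultimately show "\<Lambda> \<in> step1 p v scale h m x s (rescaled_cycle (2*s + 2) (int s))"
      using \<Lambda> by (auto simp: step1_def L_sub_def)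
  qed
qed

lemma step2_rescaled_cycle:
  "step2 p v scale h m x s (rescaled_cycle (2*s) (int s)) = rescaled_cycle (2*s) (int s - 1)"
proof -
  let ?D = "dual v h (C (2*s))"
  define I where "I = {idx (2*s) + 1..m}"
  define y where "y i = scale (of_nat p powi (- int s)) (x i)" for i
  \<comment> \<open>Lowering the scaling exponent from \<open>s\<close> to \<open>s - 1\<close>
    multiplies \<open>y i\<close> by \<open>p\<close>.\<close>
  have py: "scale (of_nat p powi (- (int s - 1))) (x i) = scale (of_nat p) (y i)" for i
    by (simp add: y_def power_int_add_1'[symmetric])
  \<comment> \<open>Beyond index \<open>idx (2*s)\<close> the norm valuation of \<open>x i\<close>
    is at least \<open>2s\<close>, exactly what division by \<open>p^s\<close> in both arguments
    consumes.\<close>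
  have yy: "h (y i) (y j) \<in> integer_ring v" if "i \<in> I" "j \<in> I" for i j
  proof (cases "i = j")
    case True
    have "i \<in> {1..m}" using that by (auto simp: I_def)
    moreover from this have "2 * int s \<le> norm_val v h (x i)"
      using le_idx_iff[of i "2*s"] that by (auto simp: I_def)
    ultimately show ?thesis
      using True by (intro integersI) (simp add: y_def form_scaled v_form_scaled)
  qed (use that in \<open>simp add: y_def form_scaled orthogonal I_def\<close>)
  have yC: "y i \<in> C (2*s)" if "i \<in> I" for i
    using that unfolding y_def I_def by (rule scale_x_in_C)
  have cycle_s: "rescaled_cycle (2*s) (int s) = {\<Lambda> \<in> vertices (C (2*s)). \<forall>i\<in>I. y i \<in> ?D \<Lambda>}"
    by (simp add: rescaled_cycle_def L_sub_def I_def y_def)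
  have cycle_s1: "rescaled_cycle (2*s) (int s - 1) =
      {\<Lambda> \<in> vertices (C (2*s)). \<forall>i\<in>I. scale (of_nat p) (y i) \<in> ?D \<Lambda>}"
    unfolding rescaled_cycle_def L_sub_def I_def py ..
  show ?thesis
  proof (intro equalityI subsetI)
    fix \<Lambda> assume "\<Lambda> \<in> step2 p v scale h m x s (rescaled_cycle (2*s) (int s))"
    then obtain \<Lambda>1 \<Lambda>2 where *: "\<Lambda> \<in> vertices (C (2*s))" "\<Lambda>1 \<in> vertices (C (2*s))"
      "\<Lambda>2 \<in> vertices (C (2*s))" "\<forall>i\<in>I. y i \<in> ?D \<Lambda>2" "\<Lambda> \<subseteq> \<Lambda>1" "\<Lambda>2 \<subseteq> \<Lambda>1"
      by (auto simp: step2_def cycle_s L_sub_def)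
    have "scale (of_nat p) (y i) \<in> ?D \<Lambda>" if "i \<in> I" for i
    proof -
      have "y i \<in> \<Lambda>1" using * that vertices_dual by blast
      then have "scale (of_nat p) (y i) \<in> ?D \<Lambda>1" using * vertices_p_dual by blast
      then show ?thesis using dual_antimono * by blast
    qed
    with * show "\<Lambda> \<in> rescaled_cycle (2*s) (int s - 1)" by (simp add: cycle_s1)
  next
    fix \<Lambda> assume "\<Lambda> \<in> rescaled_cycle (2*s) (int s - 1)"
    then have \<Lambda>: "\<Lambda> \<in> vertices (C (2*s))" "\<And>i. i \<in> I \<Longrightarrow> scale (of_nat p) (y i) \<in> ?D \<Lambda>"
      by (auto simp: cycle_s1)
    have fin: "finite (y ` I)" by (simp add: I_def)
    have yy': "h w w' \<in> integer_ring v" if "w \<in> y ` I" "w' \<in> y ` I" for w w'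
      using that yy by blast
    have yC': "y ` I \<subseteq> C (2*s)" using yC by blast
    have py': "scale (of_nat p) w \<in> ?D \<Lambda>" if "w \<in> y ` I" for w
      using that \<Lambda>(2) by blast
    \<comment> \<open>Adjoining uses integrality of \<open>p\<close> times the pairings; the passage
      to \<open>\<Lambda>2\<close> uses integrality of the pairings themselves.\<close>
    obtain \<Lambda>1 where \<Lambda>1: "\<Lambda>1 \<in> vertices (C (2*s))" "\<Lambda> \<subseteq> \<Lambda>1" "y ` I \<subseteq> \<Lambda>1"
      using vertices_enlarge[OF fin \<Lambda>(1) yC' py' integers_mult[OF integers_p yy']] by blast
    obtain \<Lambda>2 where \<Lambda>2: "\<Lambda>2 \<in> vertices (C (2*s))" "\<Lambda>2 \<subseteq> \<Lambda>1" "y ` I \<subseteq> ?D \<Lambda>2"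
      using vertices_shrink[OF nondegenerate_C fin \<Lambda>1(1,3) yy'] by blast
    have "\<Lambda>2 \<in> rescaled_cycle (2*s) (int s)"
      using \<Lambda>2 by (auto simp: cycle_s)
    with \<Lambda>(1) \<Lambda>1(1,2) \<Lambda>2(2) show "\<Lambda> \<in> step2 p v scale h m x s (rescaled_cycle (2*s) (int s))"
      unfolding step2_def L_sub_def by blast
  qed
qed

text \<open>Step (2) at index \<open>Suc s\<close> lowers the exponent to \<open>s\<close> and lives
  in \<open>C (2*s + 2)\<close>, so its output is exactly the input assumed at index
  \<open>s\<close>. At index 0 the scaling factor is 1.\<close>

lemma algorithm_loop_rescaled_cycle:
  "algorithm_loop p v scale h m x s (rescaled_cycle (2*s + 2) (int s)) = rescaled_cycle 0 0"
proof (induction s)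
  case 0
  show ?case using step1_rescaled_cycle[of 0] by simp
next
  case (Suc s)
  have "rescaled_cycle (2 * Suc s) (int (Suc s) - 1) = rescaled_cycle (2*s + 2) (int s)" by simp
  with Suc show ?case
    by (simp only: algorithm_loop.simps step1_rescaled_cycle step2_rescaled_cycle)
qed

text \<open>No norm valuation is negative, so no vector is removed at \<open>r = 0\<close> and the
  complement is the whole space.\<close>

lemma rescaled_cycle_0: "rescaled_cycle 0 0 = cycle_lattices p v scale h m x"
proof -
  have "idx 0 = 0"
    using le_idx_iff[of "idx 0" 0] norm_nonneg[of "idx 0"] idx_le[of 0] by (cases "idx 0") auto
  moreover from this have "C 0 = UNIV" by (simp add: C_sub_eq)
  ultimately show ?thesis by (simp add: rescaled_cycle_def cycle_lattices_def L_sub_def)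
qed

lemma cycle_lattices_eq_algorithm_result:
  assumes "m \<ge> 1"
  shows "cycle_lattices p v scale h m x = algorithm_result p v scale h m x"
proof -
  define s where "s = nat (norm_val v h (x m) div 2)"
  have "0 \<le> norm_val v h (x m)" using norm_nonneg assms by simp
  \<comment> \<open>Rounding down gives this bound for the largest valuation, so at the start all
    \<open>x i\<close> have been removed. The condition in \<open>rescaled_cycle\<close> is then
    vacuous, and the initial complex is a rescaled cycle.\<close>
  then have "norm_val v h (x m) < int (2*s + 2)" unfolding s_def by simp
  then have "idx (2*s + 2) = m"
    using le_idx_iff[of m "2*s + 2"] assms idx_le[of "2*s + 2"] by simp
  then have "L_sub p v scale h m x (2*s + 2) = rescaled_cycle (2*s + 2) (int s)"
    by (simp add: rescaled_cycle_def)
  then show ?thesis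
    using algorithm_loop_rescaled_cycle[of s] rescaled_cycle_0
    by (simp add: algorithm_result_def s_def[symmetric] Let_def)
qed

end

theorem theorem1p3:
  fixes p n m :: nat
    and v :: "'k::field_char_0 \<Rightarrow> int"
    and \<sigma> :: "'k \<Rightarrow> 'k"
    and scale :: "'k \<Rightarrow> 'c::ab_group_add \<Rightarrow> 'c"
    and h :: "'c \<Rightarrow> 'c \<Rightarrow> 'k"
    and b x :: "nat \<Rightarrow> 'c"
  assumes "hermitian_space p v \<sigma> scale h"
    and "odd p"
    and "n \<ge> 1"
    and "is_basis scale n b"
    and "odd (v (det (gram_matrix h n b)))"
    and "m \<ge> 1"
    and "\<And>i j. i \<in> {1..m} \<Longrightarrow> j \<in> {1..m} \<Longrightarrow> i \<noteq> j \<Longrightarrow> h (x i) (x j) = 0"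
    and "\<And>i. i \<in> {1..m} \<Longrightarrow> h (x i) (x i) \<noteq> 0 \<and> 0 \<le> norm_val v h (x i)"
    and "\<And>i j. 1 \<le> i \<Longrightarrow> i \<le> j \<Longrightarrow> j \<le> m \<Longrightarrow> norm_val v h (x i) \<le> norm_val v h (x j)"
  shows "cycle_lattices p v scale h m x = algorithm_result p v scale h m x"
proof -
  interpret orthogonal_family p v \<sigma> scale h m x
    using assms(1,7-9)
    by (intro orthogonal_family.intro orthogonal_family_axioms.intro) auto
  show ?thesis
    using assms(6) by (rule cycle_lattices_eq_algorithm_result)
qed

end
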